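(* Consider the linearly constrained problem $\min_{x\in X}\{f(x):Ax=b\}$ with smooth convex $f$, and the AC-APDHG iteration for it (defined in the context, with $Y=\mathbb{R}^m$, $g(y)=\langle b,y\rangle$, $\widetilde y_0=\mathbf 0$). Let $\mu_d>0$, $\eta_1>0$, $\beta_1=0$, $\beta_t=\beta$ for $t\ge2$ with $\beta\in(0,1-\frac{\sqrt6}{3}]$, $\tau_1=0$, $\tau_2=\mu_d$, $\widetilde\tau_1=0$, $\widetilde\tau_2=1$, $\eta_2=\min\{(1-\beta)\eta_1,\frac1{4L_{A,1}^2/\mu_d+4L_{f,1}}\}$, and for $t\ge3$ $$\eta_t=\min\Big\{\tfrac43\eta_{t-1},\ \frac{\tau_{t-2}+\mu_d}{\tau_{t-1}}\eta_{t-1},\ \frac{\tau_{t-1}}{4\mu_dL_{f,t-1}+4L_{A,t-1}^2}\Big\},$$ $$\tau_t=\tau_{t-1}+\frac{\mu_d}{2}\Big[\alpha+(1-\alpha)\eta_t\cdot\frac{4\mu_dL_{f,t-1}+4L_{A,t-1}^2}{\tau_{t-1}}\Big],\qquad\widetilde\tau_t=\frac{\tau_t}{\mu_d},$$ where $\alpha\in(0,1]$ is an absolute constant. Let $\widehat x_k=\frac{\sum_{t=1}^k\eta_{t+1}x_t}{\sum_{t=1}^k\eta_{t+1}}$ and $\widehat L_k:=\max\{\frac1{4(1-\beta)\eta_1},\frac{L_{A,1}^2}{\mu_d}+L_{f,1},\dots,\frac{L_{A,k}^2}{\mu_d}+L_{f,k}\}$. Then for every $k\ge2$, $$f(\widehat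 x_k)-f(x^* )\le\frac{12\widehat L_k}{6k+\alpha k(k-3)}\Big[\frac{\|x_0-x^*\|^2}{\beta}+\Big(\frac{5\eta_2L_{A,1}^2}{2\mu_d}+\frac{5\eta_2L_{f,1}}{2}-\frac{\eta_2}{2\eta_1}\Big)\|x_1-x_0\|^2\Big],$$ $$\|A\widehat x_k-b\|\le2\mu_d\|y^*\|+2\sqrt{\frac{12\mu_d\widehat L_k}{6k+\alpha k(k-3)}\Big[\frac{\|x_0-x^*\|^2}{\beta}+\Big(\frac{5\eta_2L_{A,1}^2}{2\mu_d}+\frac{5\eta_2L_{f,1}}{2}-\frac{\eta_2}{2\eta_1}\Big)\|x_1-x_0\|^2\Big]}.$$
   Context: Setting: $X\subseteq\mathbb{R}^n$ is a nonempty closed convex set, $A\in\mathbb{R}^{m\times n}$, $b\in\mathbb{R}^m$, and $f:X\to\mathbb{R}$ is a differentiable convex function satisfying, for some $L_f>0$ and all $x,y\in X$, $\frac1{2L_f}\|\nabla f(x)-\nabla f(y)\|^2\le f(y)-f(x)-\langle\nabla f(x),y-x\rangle\le\frac{L_f}{2}\|x-y\|^2$. Norms are Euclidean. It is assumed that there are an optimal solution $x^*$ of $\min_{x\in X}\{f(x):Ax=b\}$ and $y^*\in\mathbb{R}^m$ such that $(x^*,y^* )$ is a saddle point of $\min_{x\in X}\max_{y\in\mathbb{R}^m}f(x)+\langle Ax-b,y\rangle$. AC-APDHG iteration (for $Y=\mathbb{R}^m$, $g(y)=\langle b,y\rangle$, $\widetilde y_0=\mathbf 0$): given $x_0=\widetilde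 x_0=\bar x_0\in X$, $\mu_d>0$ and parameters $\beta_t\in[0,1)$, $\eta_t$, $\tau_t$, $\widetilde\tau_t$, set $y_0=\arg\min_{y\in\mathbb{R}^m}\{\langle-Ax_0+b,y\rangle+\frac{\mu_d}{2}\|y\|^2\}$, and for $t=1,2,\dots$ - $x_t=\arg\min_{x\in X}\{\eta_t\langle A^\top y_{t-1}+\nabla f(\widetilde x_{t-1}),x\rangle+\frac12\|\bar x_{t-1}-x\|^2\}$, - $\bar x_t=(1-\beta_t)\bar x_{t-1}+\beta_tx_t$, - $\widetilde x_t=(x_t+\widetilde\tau_t\widetilde x_{t-1})/(1+\widetilde\tau_t)$, - $y_t=\arg\min_{y\in\mathbb{R}^m}\{\langle-Ax_t+b,y\rangle+\frac{\mu_d}{2}\|y\|^2+\frac{\tau_t}{2}\|y_{t-1}-y\|^2\}$. Local estimates: $L_{A,t}=\frac{\|A^\top(y_t-y_{t-1})\|}{\|y_t-y_{t-1}\|}$ for $t\ge1$; $L_{f,1}=\frac{\|\nabla f(\widetilde x_1)-\nabla f(\widetilde x_0)\|}{\|\widetilde x_1-\widetilde x_0\|}$; $L_{f,t}=\frac{\|\nabla f(\widetilde x_t)-\nabla f(\widetilde x_{t-1})\|^2}{2[f(\widetilde x_{t-1})-f(\widetilde x_t)-\langle\nabla f(\widetilde x_t),\widetilde x_{t-1}-\widetilde x_t\rangle]}$ for $t\ge2$. Conventions: $0/0=0$ and $a/0=+\infty$ for $a>0$.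
   Formalization: The formal theorem additionally assumes that the bracket [‖x_0−x*‖²/β + (…)‖x_1−x_0‖²] is nonnegative; when it is negative the square root in the second bound is undefined and the first bound can fail. *)

theory Defs
  imports "HOL-Analysis.Analysis"
begin

text \<open>Two-sided smoothness inequality on \<open>X\<close>. \<open>X\<close> may have empty interior, in which case a
  gradient of \<open>f : X \<rightarrow> \<real>\<close> need not be unique; \<open>gradf\<close> is any gradient on \<open>X\<close> for which the
  inequality holds.\<close>

definition smooth_on_with ::
  "(real^'n) set \<Rightarrow> (real^'n \<Rightarrow> real) \<Rightarrow> (real^'n \<Rightarrow> real^'n) \<Rightarrow> real \<Rightarrow> bool" where
  "smooth_on_with X f gradf L \<longleftrightarrow>
     (\<forall>x\<in>X. (f has_derivative (\<lambda>h. h \<bullet> gradf x)) (at x within X)) \<and>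
     (\<forall>x\<in>X. \<forall>y\<in>X.
        1 / (2 * L) * (norm (gradf x - gradf y))\<^sup>2 \<le> f y - f x - gradf x \<bullet> (y - x) \<and>
        f y - f x - gradf x \<bullet> (y - x) \<le> L / 2 * (norm (x - y))\<^sup>2)"

definition saddle_point ::
  "'a set \<Rightarrow> 'b set \<Rightarrow> ('a \<Rightarrow> 'b \<Rightarrow> real) \<Rightarrow> 'a \<Rightarrow> 'b \<Rightarrow> bool" where
  "saddle_point X Y \<Phi> xs ys \<longleftrightarrow>
     xs \<in> X \<and> ys \<in> Y \<and> (\<forall>x\<in>X. \<forall>y\<in>Y. \<Phi> xs y \<le> \<Phi> xs ys \<and> \<Phi> xs ys \<le> \<Phi> x ys)"

definition ac_apdhg ::
  "(real^'n) set \<Rightarrow> (real^'n \<Rightarrow> real^'n) \<Rightarrow> real^'n^'m \<Rightarrow> real^'m \<Rightarrow> real \<Rightarrow>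
   (nat \<Rightarrow> real) \<Rightarrow> (nat \<Rightarrow> real) \<Rightarrow> (nat \<Rightarrow> real) \<Rightarrow> (nat \<Rightarrow> real) \<Rightarrow>
   (nat \<Rightarrow> real^'n) \<Rightarrow> (nat \<Rightarrow> real^'n) \<Rightarrow> (nat \<Rightarrow> real^'n) \<Rightarrow> (nat \<Rightarrow> real^'m) \<Rightarrow> bool" where
  "ac_apdhg X gradf A b \<mu> \<beta> \<eta> \<tau> \<tau>' x xbar xtil y \<longleftrightarrow>
     x 0 \<in> X \<and> xtil 0 = x 0 \<and> xbar 0 = x 0 \<and>
     is_arg_min (\<lambda>v. (b - A *v x 0) \<bullet> v + \<mu> / 2 * (norm v)\<^sup>2) (\<lambda>v. v \<in> UNIV) (y 0) \<and>
     (\<forall>t\<ge>1.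
        is_arg_min
          (\<lambda>u. \<eta> t * ((transpose A *v y (t - 1) + gradf (xtil (t - 1))) \<bullet> u)
                 + 1 / 2 * (norm (xbar (t - 1) - u))\<^sup>2)
          (\<lambda>u. u \<in> X) (x t) \<and>
        xbar t = (1 - \<beta> t) *\<^sub>R xbar (t - 1) + \<beta> t *\<^sub>R x t \<and>
        xtil t = (1 / (1 + \<tau>' t)) *\<^sub>R (x t + \<tau>' t *\<^sub>R xtil (t - 1)) \<and>
        is_arg_min
          (\<lambda>v. (b - A *v x t) \<bullet> v + \<mu> / 2 * (norm v)\<^sup>2
                 + \<tau> t / 2 * (norm (y (t - 1) - v))\<^sup>2)
          (\<lambda>v. v \<in> UNIV) (y t))"

text \<open>In the two local estimates real division implements the convention \<open>0/0 = 0\<close>; the case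
  \<open>a/0\<close> with \<open>a > 0\<close> cannot occur. For \<open>loc_LA\<close> and \<open>loc_Lf\<close> at 1 the numerator vanishes with the
  denominator; for \<open>loc_Lf\<close> at \<open>t \<ge> 2\<close> this is the lower inequality in
  \<open>smooth_on_with\<close>.\<close>

definition loc_LA :: "real^'n^'m \<Rightarrow> (nat \<Rightarrow> real^'m) \<Rightarrow> nat \<Rightarrow> real" where
  "loc_LA A y t = norm (transpose A *v (y t - y (t - 1))) / norm (y t - y (t - 1))"

definition loc_Lf ::
  "(real^'n \<Rightarrow> real) \<Rightarrow> (real^'n \<Rightarrow> real^'n) \<Rightarrow> (nat \<Rightarrow> real^'n) \<Rightarrow> nat \<Rightarrow> real" where
  "loc_Lf f gradf xtil t =
     (if t = 1 then norm (gradf (xtil 1) - gradf (xtil 0)) / norm (xtil 1 - xtil 0)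
      else (norm (gradf (xtil t) - gradf (xtil (t - 1))))\<^sup>2 /
           (2 * (f (xtil (t - 1)) - f (xtil t) - gradf (xtil t) \<bullet> (xtil (t - 1) - xtil t))))"

text \<open>The quotients whose denominator may vanish are taken in \<open>ereal\<close>, where \<open>a/0 = \<infinity>\<close> for
  \<open>a > 0\<close>, so that such a term drops out of the minimum.\<close>

definition ac_params ::
  "real \<Rightarrow> real \<Rightarrow> real \<Rightarrow> (nat \<Rightarrow> real) \<Rightarrow> (nat \<Rightarrow> real) \<Rightarrow>
   (nat \<Rightarrow> real) \<Rightarrow> (nat \<Rightarrow> real) \<Rightarrow> (nat \<Rightarrow> real) \<Rightarrow> (nat \<Rightarrow> real) \<Rightarrow> bool" where
  "ac_params \<mu> \<beta>\<^sub>0 \<alpha> LA Lf \<beta> \<eta> \<tau> \<tau>' \<longleftrightarrow>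
     \<eta> 1 > 0 \<and>
     \<beta> 1 = 0 \<and> (\<forall>t\<ge>2. \<beta> t = \<beta>\<^sub>0) \<and>
     \<tau> 1 = 0 \<and> \<tau> 2 = \<mu> \<and> \<tau>' 1 = 0 \<and> \<tau>' 2 = 1 \<and>
     ereal (\<eta> 2) =
       min (ereal ((1 - \<beta>\<^sub>0) * \<eta> 1)) (1 / ereal (4 * (LA 1)\<^sup>2 / \<mu> + 4 * Lf 1)) \<and>
     (\<forall>t\<ge>3.
        ereal (\<eta> t) =
          min (ereal (4 / 3 * \<eta> (t - 1)))
            (min (ereal ((\<tau> (t - 2) + \<mu>) / \<tau> (t - 1) * \<eta> (t - 1)))
                 (ereal (\<tau> (t - 1)) / ereal (4 * \<mu> * Lf (t - 1) + 4 * (LA (t - 1))\<^sup>2))) \<and>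
        \<tau> t = \<tau> (t - 1) + \<mu> / 2 *
                (\<alpha> + (1 - \<alpha>) * \<eta> t *
                   ((4 * \<mu> * Lf (t - 1) + 4 * (LA (t - 1))\<^sup>2) / \<tau> (t - 1))) \<and>
        \<tau>' t = \<tau> t / \<mu>)"

definition avg_iterate :: "(nat \<Rightarrow> real) \<Rightarrow> (nat \<Rightarrow> real^'n) \<Rightarrow> nat \<Rightarrow> real^'n" where
  "avg_iterate \<eta> x k =
     (1 / (\<Sum>t=1..k. \<eta> (t + 1))) *\<^sub>R (\<Sum>t=1..k. \<eta> (t + 1) *\<^sub>R x t)"

definition L_hat ::
  "real \<Rightarrow> real \<Rightarrow> real \<Rightarrow> (nat \<Rightarrow> real) \<Rightarrow> (nat \<Rightarrow> real) \<Rightarrow> nat \<Rightarrow> real" where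
  "L_hat \<mu> \<beta>\<^sub>0 \<eta>\<^sub>1 LA Lf k =
     Max (insert (1 / (4 * (1 - \<beta>\<^sub>0) * \<eta>\<^sub>1)) ((\<lambda>t. (LA t)\<^sup>2 / \<mu> + Lf t) ` {1..k}))"

text \<open>The bracket common to both bounds. It can be negative (e.g. \<open>x 0 = xs\<close>, small \<open>\<eta> 1\<close>), and
  both bounds can then fail. Its nonnegativity is what makes the square root in the feasibility
  bound meaningful.\<close>

definition init_err ::
  "real \<Rightarrow> real \<Rightarrow> (nat \<Rightarrow> real) \<Rightarrow> (nat \<Rightarrow> real) \<Rightarrow> (nat \<Rightarrow> real) \<Rightarrow>
   (nat \<Rightarrow> real^'n) \<Rightarrow> real^'n \<Rightarrow> real" where
  "init_err \<mu> \<beta>\<^sub>0 LA Lf \<eta> x xs =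
     (norm (x 0 - xs))\<^sup>2 / \<beta>\<^sub>0 +
     (5 * \<eta> 2 * (LA 1)\<^sup>2 / (2 * \<mu>) + 5 * \<eta> 2 * Lf 1 / 2 - \<eta> 2 / (2 * \<eta> 1)) * (norm (x 1 - x 0))\<^sup>2"

end

theory Submission
  imports Defs
begin

text \<open>
  The dual step is an unconstrained quadratic minimization, so it can be solved: because
  \<open>\<tau>' t = \<tau> t / \<mu>\<close>, the recursions of \<open>y\<close> and of \<open>xtil\<close> average with the same weights, and by
  induction \<open>y t = (A xtil\<^sub>t - b) / \<mu>\<close> (\<open>ac_apdhg_is_primal\<close>). The direction
  \<open>A\<^sup>T y t + \<nabla>f(xtil t)\<close> used by the primal step is therefore the gradient at \<open>xtil t\<close> of the
  quadratic penalization \<open>F u = f u + \<parallel>A u - b\<parallel>\<^sup>2 / (2 \<mu>)\<close>, and the primal-dual iteration is nothing but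
  an accelerated gradient method for \<open>F\<close> on \<open>X\<close>. The local estimates combine accordingly: with
  \<open>L t = LA t\<^sup>2 / \<mu> + Lf t\<close> and \<open>G = \<nabla>F\<close>,
  \<open>\<parallel>G (xtil t) - G (xtil (t-1))\<parallel>\<^sup>2\<close> is at most \<open>2 * L t\<close> times the Bregman divergence of \<open>F\<close>, and at
  \<open>t = 1\<close> the constant \<open>L 1\<close> is a Lipschitz bound (\<open>local_smoothness_first\<close>,
  \<open>local_smoothness_later\<close>).

  For the accelerated method, adding the optimality conditions of two consecutive prox steps bounds
  \<open>\<eta> (t+1) * (G (xtil t) \<bullet> (x t - z))\<close> by a telescoping distance to \<open>z\<close>, plus an error made of
  squared displacements and of a gradient difference (\<open>extrapolated_step\<close>). The step size rule makes
  the gradient difference absorbable by the Bregman divergence that convexity leaves over, while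
  \<open>\<beta>\<^sub>0 \<le> 1/5\<close> makes the displacements telescope (\<open>first_step_error\<close>, \<open>later_step_error\<close>). Since
  \<open>x t = xtil t + T t * (xtil t - xtil (t-1))\<close>, with \<open>T = \<tau> / \<mu>\<close>, the step-size weighted average of
  the points \<open>x t\<close> is a convex combination of the points \<open>xtil t\<close>, which yields an ergodic bound for
  \<open>F\<close> against an arbitrary comparison point of \<open>X\<close> (\<open>accelerated_ergodic_bound\<close>). That the
  point is arbitrary matters: the solution \<open>xs\<close> of the constrained problem need not minimize \<open>F\<close>.

  It remains to bound the step sizes from below, \<open>\<eta> t \<ge> (3 + \<alpha> (t-3)) / (12 L_hat)\<close>
  (\<open>stepsize_lower_bound\<close>), and to read off the two claims from
  \<open>F c - F xs \<le> \<epsilon>\<close>, where \<open>c\<close> is the average. Because \<open>F xs = f xs\<close> and \<open>f \<le> F\<close>, the first is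
  immediate; the saddle point inequality \<open>f xs \<le> f c + (A c - b) \<bullet> ys\<close> turns the same bound into a
  quadratic inequality for the residual \<open>\<parallel>A c - b\<parallel>\<close>, which gives the second.
\<close>

section \<open>Optimality conditions\<close>

definition bregman :: "('a::real_inner \<Rightarrow> real) \<Rightarrow> ('a \<Rightarrow> 'a) \<Rightarrow> 'a \<Rightarrow> 'a \<Rightarrow> real" where
  "bregman F G u v = F u - F v - G v \<bullet> (u - v)"

text \<open>Completing the square shows that a prox step is the projection of \<open>w - \<eta> *\<^sub>R g\<close> onto \<open>X\<close>; the
  inequality is the obtuse angle property of projections.\<close>

lemma prox_variational_inequality:
  fixes p :: "'a::euclidean_space"
  assumes "closed X" "convex X"
    and "is_arg_min (\<lambda>u. \<eta> * (g \<bullet> u) + 1 / 2 * (norm (w - u))\<^sup>2) (\<lambda>u. u \<in> X) p"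
    and "u \<in> X"
  shows "0 \<le> (\<eta> *\<^sub>R g + (p - w)) \<bullet> (u - p)"
proof -
  have p: "p \<in> X"
    using assms(3) by (auto simp: is_arg_min_def)
  have *: "\<eta> * (g \<bullet> v) + 1 / 2 * (norm (w - v))\<^sup>2
      = 1 / 2 * (norm (w - \<eta> *\<^sub>R g - v))\<^sup>2 + \<eta> * (g \<bullet> w) - \<eta> * \<eta> / 2 * (g \<bullet> g)" for v
    by (simp add: power2_norm_eq_inner algebra_simps inner_commute)
  have "dist (w - \<eta> *\<^sub>R g) p \<le> dist (w - \<eta> *\<^sub>R g) v" if "v \<in> X" for v
  proof -
    have "(norm (w - \<eta> *\<^sub>R g - p))\<^sup>2 \<le> (norm (w - \<eta> *\<^sub>R g - v))\<^sup>2"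
      using assms(3) that unfolding is_arg_min_def * by (force simp: not_less)
    then show ?thesis
      by (simp add: dist_norm)
  qed
  then have "(w - \<eta> *\<^sub>R g - p) \<bullet> (u - p) \<le> 0"
    using any_closest_point_dot[OF assms(2,1) p assms(4)] by blast
  then show ?thesis
    by (simp add: algebra_simps)
qed

lemma arg_min_quadratic:
  fixes v :: "'a::real_inner"
  assumes "0 < \<mu> + \<tau>"
    and "is_arg_min (\<lambda>v. c \<bullet> v + \<mu> / 2 * (norm v)\<^sup>2 + \<tau> / 2 * (norm (w - v))\<^sup>2) (\<lambda>v. v \<in> UNIV) v"
  shows "(\<mu> + \<tau>) *\<^sub>R v = \<tau> *\<^sub>R w - c"
proof -
  define s where "s = (1 / (\<mu> + \<tau>)) *\<^sub>R (\<tau> *\<^sub>R w - c)"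
  have s: "(\<mu> + \<tau>) *\<^sub>R s = \<tau> *\<^sub>R w - c"
    using assms(1) by (simp add: s_def)
  have cs: "c = \<tau> *\<^sub>R w - (\<mu> + \<tau>) *\<^sub>R s"
    using s by simp
  have *: "c \<bullet> u + \<mu> / 2 * (norm u)\<^sup>2 + \<tau> / 2 * (norm (w - u))\<^sup>2
      = (\<mu> + \<tau>) / 2 * (norm (u - s))\<^sup>2 + \<tau> / 2 * (w \<bullet> w) - (\<mu> + \<tau>) / 2 * (s \<bullet> s)" for u
    unfolding cs power2_norm_eq_inner
    by (simp add: inner_diff_left inner_diff_right inner_add_left inner_add_right inner_commute)
      (simp add: field_simps)
  have "c \<bullet> v + \<mu> / 2 * (norm v)\<^sup>2 + \<tau> / 2 * (norm (w - v))\<^sup>2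
      \<le> c \<bullet> s + \<mu> / 2 * (norm s)\<^sup>2 + \<tau> / 2 * (norm (w - s))\<^sup>2"
    using assms(2) unfolding is_arg_min_def by (meson UNIV_I not_le)
  then have "(\<mu> + \<tau>) / 2 * (norm (v - s))\<^sup>2 \<le> 0"
    unfolding * by simp
  then have "(norm (v - s))\<^sup>2 \<le> 0"
    using assms(1) by (simp add: mult_le_0_iff)
  then show ?thesis
    using s by simp
qed

section \<open>One accelerated step\<close>

text \<open>The step from \<open>x\<^sub>1\<close> to \<open>x\<^sub>2\<close> uses the gradient \<open>g\<^sub>1\<close>, but its optimality condition only controls
  \<open>g\<^sub>1 \<bullet> (x\<^sub>2 - u)\<close>. To control \<open>g\<^sub>1 \<bullet> (x\<^sub>1 - u)\<close> instead, the missing \<open>g\<^sub>1 \<bullet> (x\<^sub>1 - x\<^sub>2)\<close> is split into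
  \<open>(g\<^sub>1 - g\<^sub>0) \<bullet> (x\<^sub>1 - x\<^sub>2)\<close>, kept as an error, and \<open>g\<^sub>0 \<bullet> (x\<^sub>1 - x\<^sub>2)\<close>, which the optimality condition
  of the previous step, tested at \<open>x\<^sub>2\<close>, controls. The moving prox centre turns the distance terms
  into a telescoping difference with the factor \<open>1 / (2 * \<beta>)\<close>.\<close>

lemma extrapolated_step:
  fixes g\<^sub>0 :: "'a::real_inner"
  assumes "0 < \<beta>" "\<beta>' < 1" "0 < \<eta>'" "0 \<le> \<eta>"
    and prev: "0 \<le> (\<eta>' *\<^sub>R g\<^sub>0 + (x\<^sub>1 - w\<^sub>0)) \<bullet> (x\<^sub>2 - x\<^sub>1)"
    and curr: "0 \<le> (\<eta> *\<^sub>R g\<^sub>1 + (x\<^sub>2 - w\<^sub>1)) \<bullet> (u - x\<^sub>2)"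
    and w1: "w\<^sub>1 = (1 - \<beta>') *\<^sub>R w\<^sub>0 + \<beta>' *\<^sub>R x\<^sub>1"
    and w2: "w\<^sub>2 = (1 - \<beta>) *\<^sub>R w\<^sub>1 + \<beta> *\<^sub>R x\<^sub>2"
  shows "\<eta> * (g\<^sub>1 \<bullet> (x\<^sub>1 - u))
      \<le> ((norm (u - w\<^sub>1))\<^sup>2 - (norm (u - w\<^sub>2))\<^sup>2) / (2 * \<beta>) - (2 - \<beta>) / 2 * (norm (x\<^sub>2 - w\<^sub>1))\<^sup>2
        + \<eta> / ((1 - \<beta>') * \<eta>') * ((x\<^sub>1 - w\<^sub>1) \<bullet> (x\<^sub>2 - x\<^sub>1))
        + \<eta> * ((g\<^sub>1 - g\<^sub>0) \<bullet> (x\<^sub>1 - x\<^sub>2))"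
proof -
  have a: "((norm (u - w\<^sub>1))\<^sup>2 - (norm (u - w\<^sub>2))\<^sup>2)
      = 2 * \<beta> * ((x\<^sub>2 - w\<^sub>1) \<bullet> (u - x\<^sub>2)) + \<beta> * (2 - \<beta>) * (norm (x\<^sub>2 - w\<^sub>1))\<^sup>2"
    unfolding w2 by (simp add: power2_norm_eq_inner algebra_simps inner_commute)
  then have A: "((norm (u - w\<^sub>1))\<^sup>2 - (norm (u - w\<^sub>2))\<^sup>2) / (2 * \<beta>) - (2 - \<beta>) / 2 * (norm (x\<^sub>2 - w\<^sub>1))\<^sup>2
      = (x\<^sub>2 - w\<^sub>1) \<bullet> (u - x\<^sub>2)"
    using assms(1) by (simp add: field_simps)
  have "x\<^sub>1 - w\<^sub>1 = (1 - \<beta>') *\<^sub>R (x\<^sub>1 - w\<^sub>0)"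
    unfolding w1 by (simp add: algebra_simps)
  then have B: "\<eta> / ((1 - \<beta>') * \<eta>') * ((x\<^sub>1 - w\<^sub>1) \<bullet> (x\<^sub>2 - x\<^sub>1)) = \<eta> / \<eta>' * ((x\<^sub>1 - w\<^sub>0) \<bullet> (x\<^sub>2 - x\<^sub>1))"
    using assms(2,3) by simp
  have "0 \<le> \<eta> / \<eta>' * ((\<eta>' *\<^sub>R g\<^sub>0 + (x\<^sub>1 - w\<^sub>0)) \<bullet> (x\<^sub>2 - x\<^sub>1))"
    using prev assms(3,4) by simp
  also have "\<dots> = \<eta> * (g\<^sub>0 \<bullet> (x\<^sub>2 - x\<^sub>1)) + \<eta> / \<eta>' * ((x\<^sub>1 - w\<^sub>0) \<bullet> (x\<^sub>2 - x\<^sub>1))"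
    using assms(3) by (simp only: inner_add_left inner_scaleR_left) (simp add: field_simps)
  finally have C: "0 \<le> \<eta> * (g\<^sub>0 \<bullet> (x\<^sub>2 - x\<^sub>1)) + \<eta> / \<eta>' * ((x\<^sub>1 - w\<^sub>0) \<bullet> (x\<^sub>2 - x\<^sub>1))" .
  show ?thesis
    unfolding A B using curr C by (simp add: algebra_simps)
qed

text \<open>The next two lemmas absorb the error of one step. With \<open>w\<close> the prox centre of the step, \<open>p\<close> is
  the new iterate minus \<open>w\<close> and \<open>q\<close> the old iterate minus \<open>w\<close>. After the first step \<open>q\<close> is
  \<open>x 1 - x 0\<close>, which nothing earlier compensates, so its square stays in the final estimate. The
  gradient difference \<open>g\<close> is bounded through the Lipschitz constant, since there is no Bregman term
  yet: its weight \<open>T 1\<close> is zero.\<close>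

lemma first_step_error:
  fixes p q g :: "'a::real_inner"
  assumes "\<beta> < 1" "0 \<le> c" "c \<le> 1 - \<beta>" "0 \<le> \<eta>" "0 \<le> L" "4 * (\<eta> * L) \<le> 1"
    and g: "norm g \<le> L * norm q"
  shows "- ((2 - \<beta>) / 2 * (norm p)\<^sup>2) + c * (q \<bullet> (p - q)) + \<eta> * (g \<bullet> (q - p))
      \<le> - (norm p)\<^sup>2 / 4 + (5 / 4 * (\<eta> * L) - c / 4) * (norm q)\<^sup>2"
proof -
  define P Q e where "P = norm p" and "Q = norm q" and "e = \<eta> * L"
  have "g \<bullet> (q - p) \<le> norm g * norm (q - p)"
    by (rule norm_cauchy_schwarz)
  also have "\<dots> \<le> (L * Q) * (Q + P)"
    using g norm_triangle_ineq4[of q p] assms(5)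
    by (intro mult_mono) (auto simp: P_def Q_def)
  finally have "\<eta> * (g \<bullet> (q - p)) \<le> \<eta> * ((L * Q) * (Q + P))"
    using assms(4) by (rule mult_left_mono)
  also have "\<dots> = e * (Q\<^sup>2 + P * Q)"
    by (simp add: e_def algebra_simps power2_eq_square)
  also have "\<dots> \<le> e * (5 / 4 * Q\<^sup>2 + P\<^sup>2)"
    using zero_le_power2[of "Q / 2 - P"] assms(4,5)
    by (intro mult_left_mono) (auto simp: e_def power2_eq_square algebra_simps)
  also have "\<dots> \<le> 5 / 4 * e * Q\<^sup>2 + P\<^sup>2 / 4"
    using mult_right_mono[of e "1 / 4" "P\<^sup>2"] assms(6) by (simp add: e_def algebra_simps)
  finally have 1: "\<eta> * (g \<bullet> (q - p)) \<le> 5 / 4 * e * Q\<^sup>2 + P\<^sup>2 / 4" .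
  have "c * (q \<bullet> (p - q)) \<le> c * (P * Q - Q\<^sup>2)"
    using norm_cauchy_schwarz[of q p] assms(2)
    by (intro mult_left_mono) (auto simp: P_def Q_def power2_norm_eq_inner algebra_simps)
  also have "\<dots> \<le> c * (P\<^sup>2 / 3 - Q\<^sup>2 / 4)"
    using zero_le_power2[of "3 * Q - 2 * P"] assms(2)
    by (intro mult_left_mono) (auto simp: power2_eq_square algebra_simps)
  also have "\<dots> \<le> (1 - \<beta>) / 3 * P\<^sup>2 - c / 4 * Q\<^sup>2"
    using mult_right_mono[OF assms(3), of "P\<^sup>2 / 3"] by (simp add: algebra_simps)
  finally have 2: "c * (q \<bullet> (p - q)) \<le> (1 - \<beta>) / 3 * P\<^sup>2 - c / 4 * Q\<^sup>2" .
  have "0 \<le> (1 - \<beta>) / 6 * P\<^sup>2"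
    using assms(1) by simp
  with 1 2 show ?thesis
    unfolding P_def[symmetric] Q_def[symmetric] e_def[symmetric]
    by (simp add: field_simps)
qed

lemma quadratic_form_nonneg:
  fixes a b c P Q :: real
  assumes "0 < a" "b\<^sup>2 \<le> 4 * a * c"
  shows "0 \<le> a * P\<^sup>2 - b * (P * Q) + c * Q\<^sup>2"
proof -
  have "0 \<le> (2 * a * P - b * Q)\<^sup>2 + (4 * a * c - b\<^sup>2) * Q\<^sup>2"
    using assms by simp
  also have "\<dots> = 4 * a * (a * P\<^sup>2 - b * (P * Q) + c * Q\<^sup>2)"
    by (simp add: power2_eq_square algebra_simps)
  finally show ?thesis
    using assms(1) by (simp add: zero_le_mult_iff)
qed

text \<open>Here the gradient difference is traded, by Young's inequality, for the Bregman divergence \<open>D\<close>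
  and \<open>\<parallel>p - q\<parallel>\<^sup>2 / 8\<close>; the constant \<open>1/8\<close> is what \<open>4 * \<eta> * L \<le> \<tau>\<close> provides. The right-hand side
  telescopes: averaging moves the prox centre towards the iterate, so \<open>q\<close> is no longer than the
  \<open>p\<close> of the previous step. The bound \<open>5/3\<close> on \<open>c\<close> comes from
  \<open>\<eta> t \<le> 4/3 * \<eta> (t-1)\<close> and \<open>1 - \<beta> \<ge> 4/5\<close>.\<close>

lemma later_step_error:
  fixes p q g :: "'a::real_inner"
  assumes "\<beta> \<le> 1 / 5" "0 \<le> c" "c \<le> 5 / 3" "0 \<le> \<eta>" "0 < \<tau>" "0 \<le> L" "0 \<le> D"
    and step: "4 * \<eta> * L \<le> \<tau>"
    and g: "(norm g)\<^sup>2 \<le> 2 * L * D"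
  shows "- ((2 - \<beta>) / 2 * (norm p)\<^sup>2) + c * (q \<bullet> (p - q)) + \<eta> * (g \<bullet> (q - p))
      \<le> - (norm p)\<^sup>2 / 4 + (norm q)\<^sup>2 / 4 + \<eta> * \<tau> * D"
proof -
  have young: "\<eta> * (g \<bullet> (q - p)) \<le> \<eta> * \<tau> * D + (norm (q - p))\<^sup>2 / 8"
  proof (cases "L = 0")
    case True
    then have "g = 0"
      using g by simp
    then show ?thesis
      using assms by simp
  next
    case False
    define d where "d = norm (q - p)"
    have L: "0 < L"
      using False assms(6) by simp
    have "0 \<le> (2 * \<tau> * norm g - 2 * L * d)\<^sup>2"
      by simp
    then have "4 * \<tau> * L * (2 * norm g * d) \<le> 4 * \<tau>\<^sup>2 * (norm g)\<^sup>2 + 4 * L\<^sup>2 * d\<^sup>2"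
      by (simp add: power2_eq_square algebra_simps)
    also have "\<dots> \<le> 4 * \<tau>\<^sup>2 * (2 * L * D) + 4 * L\<^sup>2 * d\<^sup>2"
      using g by (intro add_right_mono mult_left_mono) auto
    finally have "(8 * L) * (\<tau> * (norm g * d)) \<le> (8 * L) * (\<tau> * (\<tau> * D) + L * d\<^sup>2 / 2)"
      by (simp add: power2_eq_square algebra_simps)
    then have "\<tau> * (norm g * d) \<le> \<tau> * (\<tau> * D) + L * d\<^sup>2 / 2"
      using L mult_le_cancel_left_pos[of "8 * L"] by simp
    then have "\<eta> * (\<tau> * (norm g * d)) \<le> \<eta> * (\<tau> * (\<tau> * D) + L * d\<^sup>2 / 2)"
      using assms(4) by (rule mult_left_mono)
    also have "\<dots> = \<eta> * (\<tau> * (\<tau> * D)) + (4 * \<eta> * L) * (d\<^sup>2 / 8)"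
      by (simp add: algebra_simps)
    also have "\<dots> \<le> \<eta> * (\<tau> * (\<tau> * D)) + \<tau> * (d\<^sup>2 / 8)"
      using step by (intro add_left_mono mult_right_mono) auto
    finally have "\<tau> * (\<eta> * (norm g * d)) \<le> \<tau> * (\<eta> * \<tau> * D + d\<^sup>2 / 8)"
      by (simp add: algebra_simps)
    then have "\<eta> * (norm g * d) \<le> \<eta> * \<tau> * D + d\<^sup>2 / 8"
      using assms(5) by simp
    moreover have "\<eta> * (g \<bullet> (q - p)) \<le> \<eta> * (norm g * d)"
      using norm_cauchy_schwarz[of g "q - p"] assms(4)
      by (intro mult_left_mono) (auto simp: d_def)
    ultimately show ?thesis
      by (simp add: d_def)
  qed
  define a where "a = 5 / 8 - \<beta> / 2"
  have a: "21 / 40 \<le> a"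
    using assms(1) by (simp add: a_def)
  \<comment> \<open>What remains is a quadratic form in \<open>p\<close> and \<open>q\<close>. Its discriminant condition is convex in \<open>c\<close>, so
    it suffices to have it at both ends of \<open>[0, 5/3]\<close>; \<open>0 \<le> c * (5/3 - c)\<close> expresses this.\<close>
  have "\<bar>c - 1 / 4\<bar>\<^sup>2 \<le> 21 / 10 * (c + 1 / 8)"
    using mult_nonneg_nonneg[of c "5 / 3 - c"] assms(2,3)
    by (simp add: power2_eq_square algebra_simps)
  also have "\<dots> \<le> 4 * a * (c + 1 / 8)"
    using a assms(2) by (intro mult_right_mono) auto
  finally have "0 \<le> a * (norm p)\<^sup>2 - \<bar>c - 1 / 4\<bar> * (norm p * norm q) + (c + 1 / 8) * (norm q)\<^sup>2"
    using a by (intro quadratic_form_nonneg) auto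
  moreover have "(c - 1 / 4) * (p \<bullet> q) \<le> \<bar>c - 1 / 4\<bar> * (norm p * norm q)"
  proof -
    have "(c - 1 / 4) * (p \<bullet> q) \<le> \<bar>c - 1 / 4\<bar> * \<bar>p \<bullet> q\<bar>"
      by (simp flip: abs_mult)
    also have "\<dots> \<le> \<bar>c - 1 / 4\<bar> * (norm p * norm q)"
      by (intro mult_left_mono Cauchy_Schwarz_ineq2) auto
    finally show ?thesis .
  qed
  ultimately have "(c - 1 / 4) * (p \<bullet> q) \<le> a * (p \<bullet> p) + (c + 1 / 8) * (q \<bullet> q)"
    by (simp add: power2_norm_eq_inner)
  moreover have expand: "(norm (q - p))\<^sup>2 = q \<bullet> q - 2 * (p \<bullet> q) + p \<bullet> p" "q \<bullet> (p - q) = p \<bullet> q - q \<bullet> q"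
    by (simp_all add: power2_norm_eq_inner inner_diff_left inner_diff_right inner_commute)
  ultimately show ?thesis
    using young unfolding expand power2_norm_eq_inner[of p] power2_norm_eq_inner[of q]
    by (simp add: a_def field_simps)
qed

section \<open>The accelerated method on a convex function\<close>

text \<open>Summation by parts: \<open>h t\<close> enters with the weight \<open>(1 + T t) * \<eta> (t+1)\<close> and, in the next summand,
  with \<open>- T (t+1) * \<eta> (t+2)\<close>, and the step size rule makes the sum of the two nonnegative.\<close>

lemma weighted_telescope_nonneg:
  fixes h \<eta> T :: "nat \<Rightarrow> real"
  assumes "1 \<le> k" "T 1 = 0"
    and "\<And>t. 1 \<le> t \<Longrightarrow> t \<le> k \<Longrightarrow> 0 \<le> T t \<and> 0 \<le> \<eta> (t + 1) \<and> 0 \<le> h t"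
    and "\<And>t. 1 \<le> t \<Longrightarrow> t < k \<Longrightarrow> \<eta> (t + 2) * T (t + 1) \<le> (1 + T t) * \<eta> (t + 1)"
  shows "0 \<le> (\<Sum>t=1..k. \<eta> (t + 1) * ((1 + T t) * h t - T t * h (t - 1)))"
proof -
  have "(1 + T k) * \<eta> (k + 1) * h k
      \<le> (\<Sum>t=1..k. \<eta> (t + 1) * ((1 + T t) * h t - T t * h (t - 1)))"
    using assms(1,3,4)
  proof (induction k rule: nat_induct_at_least)
    case base
    then show ?case
      using assms(2) by simp
  next
    case (Suc k)
    have "\<eta> (k + 2) * T (k + 1) * h k \<le> (1 + T k) * \<eta> (k + 1) * h k"
      using Suc.prems Suc.hyps by (intro mult_right_mono) auto
    moreover have "(1 + T k) * \<eta> (k + 1) * h k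
      \<le> (\<Sum>t=1..k. \<eta> (t + 1) * ((1 + T t) * h t - T t * h (t - 1)))"
      using Suc by auto
    ultimately show ?case
      by (simp add: algebra_simps)
  qed
  moreover have "0 \<le> (1 + T k) * \<eta> (k + 1) * h k"
    using assms(3)[of k] assms(1) by simp
  ultimately show ?thesis
    by linarith
qed

text \<open>With the gain of step \<open>t\<close> defined as \<open>\<eta> (t+1) * (g t \<bullet> (x t - z) - T t * D t)\<close>, the one-step
  estimates bound the total gain from above by induction. From below, the gain is an exact
  expression in function values at \<open>v t\<close>, \<open>v (t-1)\<close> and \<open>z\<close>, up to a Bregman divergence that is
  dropped. These values are compared with the value at the average \<open>c\<close> by linearizing \<open>F\<close> at \<open>c\<close>: the
  linear parts cancel in the weighted sum because \<open>c\<close> is the barycentre of the \<open>x t\<close>, and the remainders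
  are the Bregman divergences \<open>h t\<close>, whose weighted sum is nonnegative by
  \<open>weighted_telescope_nonneg\<close>.\<close>

theorem accelerated_ergodic_bound:
  fixes X :: "'a::real_inner set" and F :: "'a \<Rightarrow> real" and G :: "'a \<Rightarrow> 'a"
    and x w v :: "nat \<Rightarrow> 'a" and \<eta> T L :: "nat \<Rightarrow> real"
    and z :: 'a and k :: nat and \<beta> :: real
  defines "g \<equiv> \<lambda>t. G (v t)"
  defines "S \<equiv> \<Sum>t=1..k. \<eta> (t + 1)"
  defines "c \<equiv> (1 / S) *\<^sub>R (\<Sum>t=1..k. \<eta> (t + 1) *\<^sub>R x t)"
  assumes "1 \<le> k" "convex X" "z \<in> X" "0 < \<beta>" "\<beta> \<le> 1 / 5"
    and convexF: "\<And>u u'. u \<in> X \<Longrightarrow> u' \<in> X \<Longrightarrow> 0 \<le> bregman F G u u'"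
    and xX: "\<And>t. x t \<in> X" and vX: "\<And>t. v t \<in> X"
    and prox: "\<And>t u. 1 \<le> t \<Longrightarrow> u \<in> X \<Longrightarrow> 0 \<le> (\<eta> t *\<^sub>R g (t - 1) + (x t - w (t - 1))) \<bullet> (u - x t)"
    and w0: "w 0 = x 0" and w1: "w 1 = x 0"
    and w: "\<And>t. 2 \<le> t \<Longrightarrow> w t = (1 - \<beta>) *\<^sub>R w (t - 1) + \<beta> *\<^sub>R x t"
    and xv: "\<And>t. 1 \<le> t \<Longrightarrow> x t = v t + T t *\<^sub>R (v t - v (t - 1))"
    and T1: "T 1 = 0" and T: "\<And>t. 2 \<le> t \<Longrightarrow> 0 < T t"
    and \<eta>: "\<And>t. 1 \<le> t \<Longrightarrow> 0 < \<eta> t" and L: "\<And>t. 1 \<le> t \<Longrightarrow> 0 \<le> L t"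
    and L1: "norm (g 1 - g 0) \<le> L 1 * norm (x 1 - x 0)"
    and Lt: "\<And>t. 2 \<le> t \<Longrightarrow> (norm (g t - g (t - 1)))\<^sup>2 \<le> 2 * L t * bregman F G (v (t - 1)) (v t)"
    and \<eta>2: "\<eta> 2 \<le> (1 - \<beta>) * \<eta> 1" "4 * (\<eta> 2 * L 1) \<le> 1"
    and \<eta>3: "\<And>t. 3 \<le> t \<Longrightarrow> \<eta> t \<le> 4 / 3 * \<eta> (t - 1)"
            "\<And>t. 3 \<le> t \<Longrightarrow> \<eta> t * T (t - 1) \<le> (1 + T (t - 2)) * \<eta> (t - 1)"
            "\<And>t. 3 \<le> t \<Longrightarrow> 4 * \<eta> t * L (t - 1) \<le> T (t - 1)"
  shows "S * (F c - F z) \<le> (norm (x 0 - z))\<^sup>2 / (2 * \<beta>)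
      + (5 / 4 * (\<eta> 2 * L 1) - \<eta> 2 / \<eta> 1 / 4) * (norm (x 1 - x 0))\<^sup>2"
proof -
  define D where "D t = bregman F G (v (t - 1)) (v t)" for t
  define gain where "gain t = \<eta> (t + 1) * (g t \<bullet> (x t - z) - T t * D t)" for t
  have D: "0 \<le> D t" for t
    unfolding D_def using convexF vX by blast
  have \<beta>1: "\<beta> < 1"
    using assms(8) by linarith
  have potential: "(\<Sum>t=1..k. gain t)
      \<le> ((norm (z - x 0))\<^sup>2 - (norm (z - w (k + 1)))\<^sup>2) / (2 * \<beta>) - (norm (x (k + 1) - w k))\<^sup>2 / 4
        + (5 / 4 * (\<eta> 2 * L 1) - \<eta> 2 / \<eta> 1 / 4) * (norm (x 1 - x 0))\<^sup>2"
    using \<open>1 \<le> k\<close>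
  proof (induction k rule: nat_induct_at_least)
    case base
    have "\<eta> 2 * (g 1 \<bullet> (x 1 - z))
      \<le> ((norm (z - w 1))\<^sup>2 - (norm (z - w 2))\<^sup>2) / (2 * \<beta>) - (2 - \<beta>) / 2 * (norm (x 2 - w 1))\<^sup>2
        + \<eta> 2 / ((1 - 0) * \<eta> 1) * ((x 1 - w 1) \<bullet> (x 2 - x 1))
        + \<eta> 2 * ((g 1 - g 0) \<bullet> (x 1 - x 2))"
    proof (rule extrapolated_step)
      show "0 \<le> (\<eta> 1 *\<^sub>R g 0 + (x 1 - w 0)) \<bullet> (x 2 - x 1)"
        using prox[of 1 "x 2"] xX by simp
      show "0 \<le> (\<eta> 2 *\<^sub>R g 1 + (x 2 - w 1)) \<bullet> (z - x 2)"
        using prox[of 2 z] \<open>z \<in> X\<close> by simp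
    qed (use w[of 2] w0 w1 \<eta>[of 1] \<eta>[of 2] \<open>0 < \<beta>\<close> in auto)
    moreover have "- ((2 - \<beta>) / 2 * (norm (x 2 - x 0))\<^sup>2)
        + \<eta> 2 / \<eta> 1 * ((x 1 - x 0) \<bullet> ((x 2 - x 0) - (x 1 - x 0)))
        + \<eta> 2 * ((g 1 - g 0) \<bullet> ((x 1 - x 0) - (x 2 - x 0)))
      \<le> - (norm (x 2 - x 0))\<^sup>2 / 4
        + (5 / 4 * (\<eta> 2 * L 1) - \<eta> 2 / \<eta> 1 / 4) * (norm (x 1 - x 0))\<^sup>2"
      using \<eta>2 \<eta>[of 1] \<eta>[of 2] L[of 1] L1 \<open>0 < \<beta>\<close> \<beta>1
      by (intro first_step_error) (auto simp: field_simps)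
    ultimately show ?case
      using T1 w1 by (simp add: gain_def numeral_2_eq_2)
  next
    case (Suc k)
    define t where "t = k + 2"
    have t: "3 \<le> t" "t - 1 = k + 1" "t - 2 = k"
      using Suc.hyps by (auto simp: t_def)
    define q r where "q = (norm (x (k + 1) - w (k + 1)))\<^sup>2" and "r = (norm (x (k + 1) - w k))\<^sup>2"
    have wk: "w (k + 1) = (1 - \<beta>) *\<^sub>R w k + \<beta> *\<^sub>R x (k + 1)" 
      using w[of "k + 1"] Suc.hyps by simp
    have "\<eta> t * (g (k + 1) \<bullet> (x (k + 1) - z))
      \<le> ((norm (z - w (k + 1)))\<^sup>2 - (norm (z - w t))\<^sup>2) / (2 * \<beta>)
        - (2 - \<beta>) / 2 * (norm (x t - w (k + 1)))\<^sup>2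
        + \<eta> t / ((1 - \<beta>) * \<eta> (k + 1)) * ((x (k + 1) - w (k + 1)) \<bullet> (x t - x (k + 1)))
        + \<eta> t * ((g (k + 1) - g k) \<bullet> (x (k + 1) - x t))"
    proof (rule extrapolated_step)
      show "0 \<le> (\<eta> (k + 1) *\<^sub>R g k + (x (k + 1) - w k)) \<bullet> (x t - x (k + 1))"
        using prox[of "k + 1" "x t"] xX by simp
      show "0 \<le> (\<eta> t *\<^sub>R g (k + 1) + (x t - w (k + 1))) \<bullet> (z - x t)"
        using prox[of t z] \<open>z \<in> X\<close> t by simp
    qed (use w[of t] wk \<eta>[of t] \<eta>[of "k + 1"] \<open>0 < \<beta>\<close> \<beta>1 t in auto)
    moreover have "- ((2 - \<beta>) / 2 * (norm (x t - w (k + 1)))\<^sup>2)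
        + \<eta> t / ((1 - \<beta>) * \<eta> (k + 1))
          * ((x (k + 1) - w (k + 1)) \<bullet> ((x t - w (k + 1)) - (x (k + 1) - w (k + 1))))
        + \<eta> t * ((g (k + 1) - g k) \<bullet> ((x (k + 1) - w (k + 1)) - (x t - w (k + 1))))
      \<le> - (norm (x t - w (k + 1)))\<^sup>2 / 4 + (norm (x (k + 1) - w (k + 1)))\<^sup>2 / 4
        + \<eta> t * T (k + 1) * D (k + 1)"
    proof (rule later_step_error[where L = "L (k + 1)"])
      have "4 / 5 * \<eta> (k + 1) \<le> (1 - \<beta>) * \<eta> (k + 1)"
        using \<eta>[of "k + 1"] assms(8) by (intro mult_right_mono) auto
      then have "\<eta> t \<le> 5 / 3 * ((1 - \<beta>) * \<eta> (k + 1))"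
        using \<eta>3(1)[OF t(1)] t by simp
      then show "\<eta> t / ((1 - \<beta>) * \<eta> (k + 1)) \<le> 5 / 3"
        using \<eta>[of "k + 1"] \<beta>1 by (simp add: divide_le_eq)
      show "(norm (g (k + 1) - g k))\<^sup>2 \<le> 2 * L (k + 1) * D (k + 1)"
        using Lt[of "k + 1"] Suc.hyps by (simp add: D_def)
      show "4 * \<eta> t * L (k + 1) \<le> T (k + 1)"
        using \<eta>3(3)[OF t(1)] t by simp
      show "0 \<le> \<eta> t / ((1 - \<beta>) * \<eta> (k + 1))"
        using \<eta>[of "k + 1"] \<eta>[of t] t \<beta>1 by simp
    qed (use \<eta>[of t] t L T D \<open>0 < \<beta>\<close> assms(8) Suc.hyps in auto)
    moreover have "q \<le> r"
    proof -
      have "x (k + 1) - w (k + 1) = (1 - \<beta>) *\<^sub>R (x (k + 1) - w k)"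
        unfolding wk by (simp add: algebra_simps)
      then have "norm (x (k + 1) - w (k + 1)) = (1 - \<beta>) * norm (x (k + 1) - w k)"
        using \<beta>1 by simp
      also have "\<dots> \<le> 1 * norm (x (k + 1) - w k)"
        using \<open>0 < \<beta>\<close> by (intro mult_right_mono) auto
      finally show ?thesis
        by (simp add: q_def r_def)
    qed
    moreover have "gain (Suc k) = \<eta> t * (g (k + 1) \<bullet> (x (k + 1) - z)) - \<eta> t * T (k + 1) * D (k + 1)"
      by (simp add: gain_def t_def algebra_simps)
    moreover have "(\<Sum>i=1..Suc k. gain i) = (\<Sum>i=1..k. gain i) + gain (Suc k)"
      by simp
    ultimately show ?case
      using Suc.IH unfolding q_def[symmetric] r_def[symmetric] by (simp add: t_def diff_divide_distrib)
  qed
  have S: "0 < S"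
    unfolding S_def using \<eta> \<open>1 \<le> k\<close> by (intro sum_pos) auto
  have "c = (\<Sum>t=1..k. (\<eta> (t + 1) / S) *\<^sub>R x t)"
    by (simp add: c_def scaleR_sum_right)
  also have "\<dots> \<in> X"
    using S \<eta> xX \<open>convex X\<close>
    by (intro convex_sum) (auto simp: S_def sum_divide_distrib[symmetric] less_imp_le)
  finally have cX: "c \<in> X" .
  define h where "h t = bregman F G (v t) c" for t
  have "0 \<le> (\<Sum>t=1..k. \<eta> (t + 1) * ((1 + T t) * h t - T t * h (t - 1)))"
  proof (rule weighted_telescope_nonneg)
    fix t assume t: "1 \<le> t" "t \<le> k"
    have "0 \<le> T t"
      using T1 T[of t] t by (cases "t = 1") auto
    then show "0 \<le> T t \<and> 0 \<le> \<eta> (t + 1) \<and> 0 \<le> h t"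
      using \<eta>[of "t + 1"] convexF vX cX by (auto simp: h_def)
  next
    fix t assume t: "1 \<le> t" "t < k"
    then show "\<eta> (t + 2) * T (t + 1) \<le> (1 + T t) * \<eta> (t + 1)"
      using \<eta>3(2)[of "t + 2"] by simp
  qed (use \<open>1 \<le> k\<close> T1 in auto)
  moreover have "\<eta> (t + 1) * ((1 + T t) * h t - T t * h (t - 1))
      \<le> gain t - \<eta> (t + 1) * (F c - F z) - \<eta> (t + 1) * (G c \<bullet> (x t - c))" if "t \<in> {1..k}" for t
  proof -
    have t: "1 \<le> t"
      using that by simp
    have "(1 + T t) * h t - T t * h (t - 1)
        = g t \<bullet> (x t - z) - T t * D t - bregman F G z (v t) - (F c - F z) - G c \<bullet> (x t - c)"
      unfolding xv[OF t] by (simp add: h_def D_def bregman_def g_def algebra_simps inner_commute)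
    also have "\<dots> \<le> g t \<bullet> (x t - z) - T t * D t - (F c - F z) - G c \<bullet> (x t - c)"
      using convexF[OF \<open>z \<in> X\<close> vX] by simp
    finally have "\<eta> (t + 1) * ((1 + T t) * h t - T t * h (t - 1))
        \<le> \<eta> (t + 1) * (g t \<bullet> (x t - z) - T t * D t - (F c - F z) - G c \<bullet> (x t - c))"
      using \<eta>[of "t + 1"] by (intro mult_left_mono) auto
    then show ?thesis
      by (simp add: gain_def algebra_simps)
  qed
  then have "(\<Sum>t=1..k. \<eta> (t + 1) * ((1 + T t) * h t - T t * h (t - 1)))
      \<le> (\<Sum>t=1..k. gain t - \<eta> (t + 1) * (F c - F z) - \<eta> (t + 1) * (G c \<bullet> (x t - c)))"
    by (rule sum_mono)
  moreover have "\<dots> = (\<Sum>t=1..k. gain t) - S * (F c - F z) - G c \<bullet> (\<Sum>t=1..k. \<eta> (t + 1) *\<^sub>R (x t - c))"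
    by (simp add: sum_subtractf S_def sum_distrib_right inner_sum_right)
  moreover have "(\<Sum>t=1..k. \<eta> (t + 1) *\<^sub>R (x t - c)) = 0"
  proof -
    have "(\<Sum>t=1..k. \<eta> (t + 1) *\<^sub>R (x t - c)) = (\<Sum>t=1..k. \<eta> (t + 1) *\<^sub>R x t) - S *\<^sub>R c"
      by (simp add: S_def scaleR_diff_right sum_subtractf scaleR_sum_left)
    then show ?thesis
      using S by (simp add: c_def)
  qed
  ultimately have "S * (F c - F z) \<le> (\<Sum>t=1..k. gain t)"
    by simp
  also note potential
  finally have "S * (F c - F z)
      \<le> ((norm (z - x 0))\<^sup>2 - (norm (z - w (k + 1)))\<^sup>2) / (2 * \<beta>) - (norm (x (k + 1) - w k))\<^sup>2 / 4
        + (5 / 4 * (\<eta> 2 * L 1) - \<eta> 2 / \<eta> 1 / 4) * (norm (x 1 - x 0))\<^sup>2" .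
  moreover have "((norm (z - x 0))\<^sup>2 - (norm (z - w (k + 1)))\<^sup>2) / (2 * \<beta>) \<le> (norm (z - x 0))\<^sup>2 / (2 * \<beta>)"
    using \<open>0 < \<beta>\<close> by (intro divide_right_mono) auto
  moreover have "0 \<le> (norm (x (k + 1) - w k))\<^sup>2 / 4"
    by simp
  ultimately show ?thesis
    unfolding norm_minus_commute[of z "x 0"] by linarith
qed

section \<open>Growth of the step sizes\<close>

text \<open>The linear lower bound propagates through each entry of the minimum. The last entry grows at
  rate \<open>\<alpha>/2\<close> because \<open>T\<close> does. The first two multiply the previous step size by \<open>4/3\<close> or by
  \<open>(T (t-2) + 1) / T (t-1)\<close>, whereas the lower bound grows by \<open>1 + \<alpha> / (3 + \<alpha> (t-4))\<close> only; for the
  second ratio this follows from \<open>T (t-1) - T (t-2) \<le> 1/2\<close> and hence \<open>T (t-1) \<le> (t-1)/2\<close>.\<close>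

lemma stepsize_lower_bound:
  fixes \<eta> T :: "nat \<Rightarrow> real"
  assumes "0 \<le> \<alpha>" "\<alpha> \<le> 1" "0 < M" "T 1 = 0" "T 2 = 1" "1 / (4 * M) \<le> \<eta> 2"
    and step: "\<And>t. 3 \<le> t \<Longrightarrow> t \<le> n \<Longrightarrow>
        min (min (4 / 3 * \<eta> (t - 1)) ((T (t - 2) + 1) / T (t - 1) * \<eta> (t - 1))) (T (t - 1) / (4 * M)) \<le> \<eta> t"
    and T: "\<And>t. 3 \<le> t \<Longrightarrow> T (t - 1) + \<alpha> / 2 \<le> T t \<and> T t \<le> T (t - 1) + 1 / 2"
    and "2 \<le> t" "t \<le> n"
  shows "(3 + \<alpha> * (real t - 3)) / (12 * M) \<le> \<eta> t"
proof -
  have T_bounds: "1 + \<alpha> / 2 * (real t - 2) \<le> T t \<and> T t \<le> real t / 2" if "2 \<le> t" for t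
    using that
  proof (induction t rule: nat_induct_at_least)
    case (Suc t)
    then show ?case
      using T[of "Suc t"] by (simp add: field_simps)
  qed (simp add: assms(5))
  show ?thesis
    using assms(9,10)
  proof (induction t rule: nat_induct_at_least)
    case base
    have "(3 + \<alpha> * (real 2 - 3)) / (12 * M) \<le> 3 / (12 * M)"
      using assms(1,3) by (intro divide_right_mono) auto
    then show ?case
      using assms(6) by simp
  next
    case (Suc t)
    show ?case
    proof (cases "t = 2")
      case True
      \<comment> \<open>Here \<open>(T 1 + 1) / T 2 = 1\<close>: the third step size may equal the second, so the linear growth
        only starts afterwards.\<close>
      define m where "m = 1 / (4 * M)"
      have "0 < m" "m \<le> \<eta> 2"
        using assms(3,6) by (auto simp: m_def)
      moreover have "min (min (4 / 3 * \<eta> 2) (\<eta> 2)) m \<le> \<eta> 3"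
        using step[of 3] Suc.prems True assms(4,5) by (simp add: m_def)
      ultimately have "m \<le> \<eta> 3"
        by linarith
      then show ?thesis
        using True by (simp add: m_def)
    next
      case False
      define N where "N = 3 + \<alpha> * (real t - 3)"
      have t: "3 \<le> t"
        using False Suc.hyps by simp
      have N: "3 \<le> N"
        using t assms(1) by (simp add: N_def)
      have "0 \<le> \<alpha> / 2 * (real t - 2)"
        using t assms(1) by simp
      then have Tt: "0 < T t"
        using T_bounds[OF Suc.hyps] by linarith
      have IH: "N / (12 * M) \<le> \<eta> t"
        using Suc by (simp add: N_def)
      have grow: "(N + \<alpha>) / (12 * M) \<le> \<rho> * \<eta> t" if "N + \<alpha> \<le> \<rho> * N" "0 \<le> \<rho>" for \<rho>
      proof -
        have "(N + \<alpha>) / (12 * M) \<le> \<rho> * N / (12 * M)"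
          using that assms(3) by (intro divide_right_mono) auto
        also have "\<dots> \<le> \<rho> * \<eta> t"
          using mult_left_mono[OF IH \<open>0 \<le> \<rho>\<close>] by simp
        finally show ?thesis .
      qed
      have 1: "(N + \<alpha>) / (12 * M) \<le> 4 / 3 * \<eta> t"
        using N assms(2) by (intro grow) auto
      have 2: "(N + \<alpha>) / (12 * M) \<le> (T (t - 1) + 1) / T t * \<eta> t"
      proof (rule grow)
        have "2 * \<alpha> * T t \<le> \<alpha> * real t"
          using T_bounds[OF Suc.hyps] assms(1) mult_left_mono[of "T t" "real t / 2" "2 * \<alpha>"] by simp
        also have "\<dots> \<le> N"
          using assms(2) by (simp add: N_def algebra_simps)
        finally have "(N + \<alpha>) * T t \<le> (T t + 1 / 2) * N"
          by (simp add: algebra_simps)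
        also have "\<dots> \<le> (T (t - 1) + 1) * N"
          using T[OF t] N by (intro mult_right_mono) auto
        finally show "N + \<alpha> \<le> (T (t - 1) + 1) / T t * N"
          using Tt by (simp add: field_simps)
        show "0 \<le> (T (t - 1) + 1) / T t"
          using T[OF t] Tt by (intro divide_nonneg_nonneg) auto
      qed
      have 3: "(N + \<alpha>) / (12 * M) \<le> T t / (4 * M)"
      proof -
        have "0 \<le> \<alpha> * (real t - 2)"
          using t assms(1) by simp
        then have "N + \<alpha> \<le> 3 * T t"
          using conjunct1[OF T_bounds[OF Suc.hyps]] by (simp add: N_def algebra_simps)
        then have "(N + \<alpha>) / (12 * M) \<le> 3 * T t / (12 * M)"
          using assms(3) by (intro divide_right_mono) auto
        then show ?thesis
          by simp
      qed
      have "Suc t - 1 = t" "Suc t - 2 = t - 1" "3 \<le> Suc t"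
        using t by auto
      then have "min (min (4 / 3 * \<eta> t) ((T (t - 1) + 1) / T t * \<eta> t)) (T t / (4 * M)) \<le> \<eta> (Suc t)"
        using step[of "Suc t"] Suc.prems by metis
      then have "(N + \<alpha>) / (12 * M) \<le> \<eta> (Suc t)"
        using 1 2 3 by linarith
      then show ?thesis
        by (simp add: N_def algebra_simps)
    qed
  qed
qed

text \<open>The rule of the step sizes in real terms: if \<open>c = 0\<close>, the quotient is infinite and drops out of
  the minimum.\<close>

lemma ereal_min_quotient:
  fixes e a n c :: real
  assumes "ereal e = min (ereal a) (ereal n / ereal c)" "0 < a" "0 < n" "0 \<le> c"
  shows "0 < e" "e \<le> a" "e * c \<le> n" "c \<le> M \<Longrightarrow> 0 < M \<Longrightarrow> min a (n / M) \<le> e"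
proof -
  have *: "e = (if c = 0 then a else min a (n / c))"
  proof (cases "c = 0")
    case True
    then have "ereal n / ereal c = \<infinity>"
      using ereal_divide[of n 0] assms(3) by simp
    then show ?thesis
      using assms(1) True by simp
  next
    case False
    then have "ereal e = ereal (min a (n / c))"
      using assms(1) by (simp add: min_def)
    then show ?thesis
      using False unfolding ereal.inject by simp
  qed
  show "0 < e" "e \<le> a"
    using assms(2-4) by (auto simp: *)
  show "e * c \<le> n"
    using assms(2-4) by (auto simp: * min_def field_simps)
  show "min a (n / M) \<le> e" if "c \<le> M" "0 < M"
  proof (cases "c = 0")
    case False
    then have "n / M \<le> n / c"
      using that assms(3,4) by (intro divide_left_mono) auto
    then show ?thesis
      using False by (auto simp: *)
  qed (simp add: *)
qed

lemma ac_params_initial: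
  assumes "ac_params \<mu> \<beta>\<^sub>0 \<alpha> LA Lf \<beta> \<eta> \<tau> \<tau>'"
  shows "0 < \<eta> 1" "\<beta> 1 = 0" "\<tau> 1 = 0" "\<tau> 2 = \<mu>" "\<tau>' 1 = 0" "\<tau>' 2 = 1"
    and "ereal (\<eta> 2) =
      min (ereal ((1 - \<beta>\<^sub>0) * \<eta> 1)) (ereal 1 / ereal (4 * (LA 1)\<^sup>2 / \<mu> + 4 * Lf 1))"
  using assms unfolding ac_params_def one_ereal_def by blast+

text \<open>Only the estimates \<open>Lf s\<close> with \<open>s < t\<close> may be assumed nonnegative: the sign of \<open>Lf t\<close> relies on
  \<open>xtil t \<in> X\<close>, and this in turn on \<open>\<tau> t \<ge> 0\<close>.\<close>

lemma ac_params_pos: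
  assumes params: "ac_params \<mu> \<beta>\<^sub>0 \<alpha> LA Lf \<beta> \<eta> \<tau> \<tau>'"
    and "0 < \<mu>" "\<beta>\<^sub>0 < 1" "0 \<le> \<alpha>" "\<alpha> \<le> 1"
    and "\<And>s. 1 \<le> s \<Longrightarrow> s < t \<Longrightarrow> 0 \<le> Lf s" "1 \<le> t"
  shows "0 < \<eta> t \<and> 0 \<le> \<tau> t \<and> (2 \<le> t \<longrightarrow> 0 < \<tau> t)"
  using assms(6,7)
proof (induction t rule: less_induct)
  case (less t)
  have \<eta>1: "0 < \<eta> 1"
    using params by (rule ac_params_initial)
  consider "t = 1" | "t = 2" | "3 \<le> t"
    using less.prems by linarith
  then show ?case
  proof cases
    case 1
    then show ?thesis
      using ac_params_initial[OF params] by simp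
  next
    case 2
    have "0 < \<eta> 2"
      using less.prems(1)[of 1] 2 \<eta>1 assms(2,3) by (intro ereal_min_quotient(1)[OF ac_params_initial(7)[OF params]]) auto
    then show ?thesis
      using 2 ac_params_initial(4)[OF params] \<open>0 < \<mu>\<close> by simp
  next
    case 3
    define c where "c = 4 * \<mu> * Lf (t - 1) + 4 * (LA (t - 1))\<^sup>2"
    define a where "a = min (4 / 3 * \<eta> (t - 1)) ((\<tau> (t - 2) + \<mu>) / \<tau> (t - 1) * \<eta> (t - 1))"
    have prev: "0 < \<eta> (t - 1) \<and> 0 \<le> \<tau> (t - 1) \<and> (2 \<le> t - 1 \<longrightarrow> 0 < \<tau> (t - 1))"
      using 3 less.prems by (intro less.IH) auto
    moreover have "0 < \<eta> (t - 2) \<and> 0 \<le> \<tau> (t - 2) \<and> (2 \<le> t - 2 \<longrightarrow> 0 < \<tau> (t - 2))"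
      using 3 less.prems by (intro less.IH) auto
    ultimately have a: "0 < a" and \<tau>: "0 < \<tau> (t - 1)"
      using 3 \<open>0 < \<mu>\<close> by (auto simp: a_def)
    have c: "0 \<le> c"
      using less.prems(1)[of "t - 1"] 3 \<open>0 < \<mu>\<close> by (auto simp: c_def)
    have e: "ereal (\<eta> t) = min (ereal a) (ereal (\<tau> (t - 1)) / ereal c)"
      using params 3 unfolding ac_params_def a_def c_def ereal_min min.assoc by blast
    have "0 < \<eta> t"
      using a \<tau> c by (rule ereal_min_quotient(1)[OF e])
    moreover have "\<tau> t = \<tau> (t - 1) + \<mu> / 2 * (\<alpha> + (1 - \<alpha>) * \<eta> t * (c / \<tau> (t - 1)))"
      using params 3 unfolding ac_params_def c_def by blast
    ultimately have "\<tau> (t - 1) \<le> \<tau> t"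
      using c \<tau> assms(2-5) by simp
    then show ?thesis
      using \<open>0 < \<eta> t\<close> \<tau> by simp
  qed
qed

text \<open>Dividing \<open>\<tau>\<close> by \<open>\<mu>\<close> and merging both local estimates into \<open>L\<close> removes \<open>\<mu>\<close> from the rules. The
  increment of \<open>T\<close> is half a convex combination of \<open>1\<close> and
  \<open>4 * \<eta> t * L (t-1) / T (t-1) \<in> [0, 1]\<close>.\<close>

lemma ac_params_normalized:
  fixes \<mu> \<beta>\<^sub>0 \<alpha> :: real and \<eta> \<tau> \<tau>' \<beta> LA Lf :: "nat \<Rightarrow> real"
  defines "T \<equiv> \<lambda>t. \<tau> t / \<mu>" and "L \<equiv> \<lambda>t. (LA t)\<^sup>2 / \<mu> + Lf t"
  assumes params: "ac_params \<mu> \<beta>\<^sub>0 \<alpha> LA Lf \<beta> \<eta> \<tau> \<tau>'"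
    and "0 < \<mu>" "\<beta>\<^sub>0 < 1" "0 \<le> \<alpha>" "\<alpha> \<le> 1"
    and Lf: "\<forall>s\<ge>1. 0 \<le> Lf s"
  shows "\<eta> 2 \<le> (1 - \<beta>\<^sub>0) * \<eta> 1" "4 * (\<eta> 2 * L 1) \<le> 1"
    and "\<And>M. L 1 \<le> M \<Longrightarrow> 0 < M \<Longrightarrow> min ((1 - \<beta>\<^sub>0) * \<eta> 1) (1 / (4 * M)) \<le> \<eta> 2"
    and "\<And>t. 3 \<le> t \<Longrightarrow> \<eta> t \<le> 4 / 3 * \<eta> (t - 1)"
    and "\<And>t. 3 \<le> t \<Longrightarrow> \<eta> t * T (t - 1) \<le> (1 + T (t - 2)) * \<eta> (t - 1)"
    and "\<And>t. 3 \<le> t \<Longrightarrow> 4 * \<eta> t * L (t - 1) \<le> T (t - 1)"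
    and "\<And>t M. 3 \<le> t \<Longrightarrow> L (t - 1) \<le> M \<Longrightarrow> 0 < M \<Longrightarrow>
        min (min (4 / 3 * \<eta> (t - 1)) ((T (t - 2) + 1) / T (t - 1) * \<eta> (t - 1))) (T (t - 1) / (4 * M)) \<le> \<eta> t"
    and "\<And>t. 3 \<le> t \<Longrightarrow> T (t - 1) + \<alpha> / 2 \<le> T t \<and> T t \<le> T (t - 1) + 1 / 2"
proof -
  have pos: "0 < \<eta> t \<and> 0 \<le> \<tau> t \<and> (2 \<le> t \<longrightarrow> 0 < \<tau> t)" if "1 \<le> t" for t
    using assms that by (intro ac_params_pos[OF params]) auto
  have e2: "ereal (\<eta> 2) = min (ereal ((1 - \<beta>\<^sub>0) * \<eta> 1)) (ereal 1 / ereal (4 * L 1))"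
    using ac_params_initial(7)[OF params] by (simp add: L_def algebra_simps)
  have prem2: "0 < (1 - \<beta>\<^sub>0) * \<eta> 1" "0 < (1::real)" "0 \<le> 4 * L 1"
    using pos[of 1] Lf[rule_format, of 1] \<open>\<beta>\<^sub>0 < 1\<close> \<open>0 < \<mu>\<close> by (auto simp: L_def)
  note q2 = ereal_min_quotient[OF e2 prem2]
  show "\<eta> 2 \<le> (1 - \<beta>\<^sub>0) * \<eta> 1" "4 * (\<eta> 2 * L 1) \<le> 1"
    using q2(2,3) by auto
  show "min ((1 - \<beta>\<^sub>0) * \<eta> 1) (1 / (4 * M)) \<le> \<eta> 2" if "L 1 \<le> M" "0 < M" for M
    using q2(4)[of "4 * M"] that by simp
  fix t :: nat
  assume t: "3 \<le> t"
  have \<tau>: "0 < \<tau> (t - 1)" and \<tau>2: "0 \<le> \<tau> (t - 2)" and \<eta>: "0 < \<eta> (t - 1)"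
    using pos[of "t - 1"] pos[of "t - 2"] t by auto
  have L: "0 \<le> L (t - 1)"
    using Lf[rule_format, of "t - 1"] t \<open>0 < \<mu>\<close> by (auto simp: L_def)
  define a where "a = min (4 / 3 * \<eta> (t - 1)) ((\<tau> (t - 2) + \<mu>) / \<tau> (t - 1) * \<eta> (t - 1))"
  have ratio: "(\<tau> (t - 2) + \<mu>) / \<tau> (t - 1) = (T (t - 2) + 1) / T (t - 1)"
    using \<open>0 < \<mu>\<close> \<tau> by (simp add: T_def field_simps)
  have c: "4 * \<mu> * Lf (t - 1) + 4 * (LA (t - 1))\<^sup>2 = \<mu> * (4 * L (t - 1))"
    using \<open>0 < \<mu>\<close> by (simp add: L_def field_simps)
  have e: "ereal (\<eta> t) = min (ereal a) (ereal (\<tau> (t - 1)) / ereal (\<mu> * (4 * L (t - 1))))"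
    using params t unfolding ac_params_def a_def c[symmetric] ereal_min min.assoc by blast
  have prem: "0 < a" "0 < \<tau> (t - 1)" "0 \<le> \<mu> * (4 * L (t - 1))"
    using \<tau> \<tau>2 \<eta> L \<open>0 < \<mu>\<close> by (auto simp: a_def)
  note q = ereal_min_quotient[OF e prem]
  show "\<eta> t \<le> 4 / 3 * \<eta> (t - 1)"
    using q(2) by (simp add: a_def)
  have "\<eta> t \<le> (T (t - 2) + 1) / T (t - 1) * \<eta> (t - 1)"
    using q(2) unfolding a_def ratio by simp
  moreover have T1: "0 < T (t - 1)"
    using \<tau> \<open>0 < \<mu>\<close> by (simp add: T_def)
  ultimately show "\<eta> t * T (t - 1) \<le> (1 + T (t - 2)) * \<eta> (t - 1)"
    by (simp add: field_simps)
  show step: "4 * \<eta> t * L (t - 1) \<le> T (t - 1)"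
    using q(3) \<open>0 < \<mu>\<close> by (simp add: T_def field_simps)
  show "min (min (4 / 3 * \<eta> (t - 1)) ((T (t - 2) + 1) / T (t - 1) * \<eta> (t - 1))) (T (t - 1) / (4 * M)) \<le> \<eta> t"
    if "L (t - 1) \<le> M" "0 < M" for M
    using q(4)[of "\<mu> * (4 * M)"] that \<open>0 < \<mu>\<close> unfolding a_def ratio by (simp add: T_def mult.left_commute)
  define r where "r = 4 * \<eta> t * L (t - 1) / T (t - 1)"
  have r: "0 \<le> r" "r \<le> 1"
    using step T1 L q(1) by (auto simp: r_def)
  have "\<tau> t = \<tau> (t - 1) + \<mu> / 2 * (\<alpha> + (1 - \<alpha>) * \<eta> t * (\<mu> * (4 * L (t - 1)) / \<tau> (t - 1)))"
    using params t unfolding ac_params_def c[symmetric] by blast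
  then have "T t = T (t - 1) + (\<alpha> + (1 - \<alpha>) * r) / 2"
    using \<open>0 < \<mu>\<close> \<tau> by (simp add: T_def r_def field_simps)
  moreover have "0 \<le> (1 - \<alpha>) * r" "(1 - \<alpha>) * r \<le> 1 - \<alpha>"
    using r \<open>\<alpha> \<le> 1\<close> by (auto intro: mult_left_le)
  ultimately show "T (t - 1) + \<alpha> / 2 \<le> T t \<and> T t \<le> T (t - 1) + 1 / 2"
    by simp
qed

section \<open>Elimination of the dual iterates\<close>

definition penalized ::
  "real \<Rightarrow> real^'n^'m \<Rightarrow> real^'m \<Rightarrow> (real^'n \<Rightarrow> real) \<Rightarrow> real^'n \<Rightarrow> real" where
  "penalized \<mu> A b f u = f u + (norm (A *v u - b))\<^sup>2 / (2 * \<mu>)"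

definition penalized_grad ::
  "real \<Rightarrow> real^'n^'m \<Rightarrow> real^'m \<Rightarrow> (real^'n \<Rightarrow> real^'n) \<Rightarrow> real^'n \<Rightarrow> real^'n" where
  "penalized_grad \<mu> A b G u = G u + transpose A *v ((1 / \<mu>) *\<^sub>R (A *v u - b))"

lemma transpose_inner: "(transpose A *v w) \<bullet> u = w \<bullet> (A *v u)" for A :: "real^'n^'m"
  by (simp add: dot_lmul_matrix)

lemma bregman_penalized:
  assumes "\<mu> \<noteq> 0"
  shows "bregman (penalized \<mu> A b f) (penalized_grad \<mu> A b G) u v
    = bregman f G u v + (norm (A *v (u - v)))\<^sup>2 / (2 * \<mu>)"
proof -
  have shift: "A *v u - b = (A *v v - b) + A *v (u - v)"
    by (simp add: matrix_vector_mult_diff_distrib)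
  have "(norm (A *v u - b))\<^sup>2
      = (norm (A *v v - b))\<^sup>2 + 2 * ((A *v v - b) \<bullet> (A *v (u - v))) + (norm (A *v (u - v)))\<^sup>2"
    unfolding shift power2_norm_eq_inner inner_add_left inner_add_right
    by (simp add: inner_commute)
  moreover have "penalized_grad \<mu> A b G v \<bullet> (u - v)
      = G v \<bullet> (u - v) + (A *v v - b) \<bullet> (A *v (u - v)) / \<mu>"
    by (simp add: penalized_grad_def inner_add_left transpose_inner del: transpose_matrix_vector)
  ultimately show ?thesis
    using assms by (simp add: bregman_def penalized_def add_divide_distrib)
qed

text \<open>Cauchy-Schwarz in the plane. It is the reason why local smoothness constants of two functions,
  each measured relative to its own Bregman divergence, add up for the sum of the functions.\<close>

lemma norm_add_squared_le:
  fixes a b :: "'a::real_normed_vector"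
  assumes "(norm a)\<^sup>2 \<le> P * D" "(norm b)\<^sup>2 \<le> Q * E" "0 \<le> P" "0 \<le> Q" "0 \<le> D" "0 \<le> E"
  shows "(norm (a + b))\<^sup>2 \<le> (P + Q) * (D + E)"
proof -
  have "(2 * (norm a * norm b))\<^sup>2 = 4 * ((norm a)\<^sup>2 * (norm b)\<^sup>2)"
    by (simp add: power_mult_distrib)
  also have "\<dots> \<le> 4 * ((P * D) * (Q * E))"
    using assms by (intro mult_left_mono mult_mono) auto
  also have "\<dots> \<le> (P * E + Q * D)\<^sup>2"
    using zero_le_power2[of "P * E - Q * D"] by (simp add: power2_eq_square algebra_simps)
  finally have "2 * (norm a * norm b) \<le> P * E + Q * D"
    by (rule power2_le_imp_le) (use assms in simp)
  moreover have "(norm (a + b))\<^sup>2 \<le> (norm a)\<^sup>2 + (norm b)\<^sup>2 + 2 * (norm a * norm b)"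
    using power_mono[OF norm_triangle_ineq[of a b], of 2] by (simp add: power2_sum)
  moreover have "(P + Q) * (D + E) = P * D + Q * E + (P * E + Q * D)"
    by (simp add: algebra_simps)
  ultimately show ?thesis
    using assms(1,2) by linarith
qed

lemma ac_apdhg_step:
  assumes "ac_apdhg X gradf A b \<mu> \<beta> \<eta> \<tau> \<tau>' x xbar xtil y" and "1 \<le> t"
  shows "is_arg_min
      (\<lambda>u. \<eta> t * ((transpose A *v y (t - 1) + gradf (xtil (t - 1))) \<bullet> u)
             + 1 / 2 * (norm (xbar (t - 1) - u))\<^sup>2) (\<lambda>u. u \<in> X) (x t)"
    and "xbar t = (1 - \<beta> t) *\<^sub>R xbar (t - 1) + \<beta> t *\<^sub>R x t"
    and "xtil t = (1 / (1 + \<tau>' t)) *\<^sub>R (x t + \<tau>' t *\<^sub>R xtil (t - 1))"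
    and "is_arg_min
      (\<lambda>v. (b - A *v x t) \<bullet> v + \<mu> / 2 * (norm v)\<^sup>2 + \<tau> t / 2 * (norm (y (t - 1) - v))\<^sup>2)
      (\<lambda>v. v \<in> UNIV) (y t)"
  using assms unfolding ac_apdhg_def by blast+

text \<open>Both recursions are affine averages: \<open>(\<mu> + \<tau> t) y t = (A x\<^sub>t - b) + \<tau> t y (t-1)\<close>, and
  \<open>(\<mu> + \<tau> t) xtil t = \<mu> x t + \<tau> t xtil (t-1)\<close>. Applying the affine map \<open>u \<mapsto> (A u - b) / \<mu>\<close> to the
  second gives the first.\<close>

lemma ac_apdhg_is_primal:
  fixes A :: "real^'n^'m"
  assumes alg: "ac_apdhg X gradf A b \<mu> \<beta> \<eta> \<tau> \<tau>' x xbar xtil y" and "0 < \<mu>"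
    and \<tau>: "\<And>t. 1 \<le> t \<Longrightarrow> t \<le> n \<Longrightarrow> 0 \<le> \<tau> t \<and> \<tau>' t = \<tau> t / \<mu>"
    and "t \<le> n"
  shows "y t = (1 / \<mu>) *\<^sub>R (A *v xtil t - b)"
  using \<open>t \<le> n\<close>
proof (induction t)
  case 0
  have "is_arg_min (\<lambda>v. (b - A *v x 0) \<bullet> v + \<mu> / 2 * (norm v)\<^sup>2 + 0 / 2 * (norm (0 - v))\<^sup>2)
      (\<lambda>v. v \<in> UNIV) (y 0)"
    using alg by (simp add: ac_apdhg_def)
  from arg_min_quadratic[OF _ this] have "\<mu> *\<^sub>R y 0 = A *v x 0 - b"
    using \<open>0 < \<mu>\<close> by simp
  then have "(1 / \<mu>) *\<^sub>R (\<mu> *\<^sub>R y 0) = (1 / \<mu>) *\<^sub>R (A *v x 0 - b)"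
    by simp
  then show ?case
    using alg \<open>0 < \<mu>\<close> by (simp add: ac_apdhg_def)
next
  case (Suc t)
  define \<sigma> where "\<sigma> = \<tau> (Suc t)"
  have \<sigma>: "0 \<le> \<sigma>" "\<tau>' (Suc t) = \<sigma> / \<mu>"
    using \<tau>[of "Suc t"] Suc.prems by (auto simp: \<sigma>_def)
  have "is_arg_min (\<lambda>v. (b - A *v x (Suc t)) \<bullet> v + \<mu> / 2 * (norm v)\<^sup>2 + \<sigma> / 2 * (norm (y t - v))\<^sup>2)
      (\<lambda>v. v \<in> UNIV) (y (Suc t))"
    using ac_apdhg_step(4)[OF alg, of "Suc t"] by (simp add: \<sigma>_def)
  from arg_min_quadratic[OF _ this]
  have 1: "(\<mu> + \<sigma>) *\<^sub>R y (Suc t) = A *v x (Suc t) - b + \<sigma> *\<^sub>R y t"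
    using \<open>0 < \<mu>\<close> \<sigma> by (simp add: algebra_simps)
  have "xtil (Suc t) = (1 / (1 + \<sigma> / \<mu>)) *\<^sub>R (x (Suc t) + (\<sigma> / \<mu>) *\<^sub>R xtil t)"
    using ac_apdhg_step(3)[OF alg, of "Suc t"] by (simp add: \<sigma>(2))
  moreover have "1 + \<sigma> / \<mu> = (\<mu> + \<sigma>) / \<mu>" "(\<mu> + \<sigma>) / \<mu> \<noteq> 0"
    using \<open>0 < \<mu>\<close> \<sigma>(1) by (simp add: add_divide_distrib, simp)
  ultimately have "((\<mu> + \<sigma>) / \<mu>) *\<^sub>R xtil (Suc t) = x (Suc t) + (\<sigma> / \<mu>) *\<^sub>R xtil t"
    by simp
  then have "((\<mu> + \<sigma>) / \<mu>) *\<^sub>R (A *v xtil (Suc t)) = A *v x (Suc t) + (\<sigma> / \<mu>) *\<^sub>R (A *v xtil t)"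
    by (metis matrix_vector_mult_scaleR matrix_vector_right_distrib)
  moreover have "((\<mu> + \<sigma>) / \<mu>) *\<^sub>R b = b + (\<sigma> / \<mu>) *\<^sub>R b"
    using \<open>0 < \<mu>\<close> by (simp add: add_divide_distrib scaleR_left_distrib)
  ultimately have "((\<mu> + \<sigma>) / \<mu>) *\<^sub>R (A *v xtil (Suc t) - b) = (\<mu> + \<sigma>) *\<^sub>R y (Suc t)"
    using 1 Suc by (simp add: scaleR_diff_right)
  then have "(1 / (\<mu> + \<sigma>)) *\<^sub>R (((\<mu> + \<sigma>) / \<mu>) *\<^sub>R (A *v xtil (Suc t) - b)) 
      = (1 / (\<mu> + \<sigma>)) *\<^sub>R ((\<mu> + \<sigma>) *\<^sub>R y (Suc t))"
    by simp
  then show ?case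
    using \<open>0 < \<mu>\<close> \<sigma>(1) by simp
qed

lemma smooth_bregman_nonneg:
  assumes "smooth_on_with X f gradf L" "0 < L" "u \<in> X" "v \<in> X"
  shows "1 / (2 * L) * (norm (gradf v - gradf u))\<^sup>2 \<le> bregman f gradf u v" "0 \<le> bregman f gradf u v"
proof -
  show 1: "1 / (2 * L) * (norm (gradf v - gradf u))\<^sup>2 \<le> bregman f gradf u v"
    using assms by (auto simp: smooth_on_with_def bregman_def)
  have "0 \<le> 1 / (2 * L) * (norm (gradf v - gradf u))\<^sup>2"
    using assms by simp
  with 1 show "0 \<le> bregman f gradf u v"
    by linarith
qed

text \<open>Membership and the sign of the parameters are proved together by strong induction: \<open>\<tau> t\<close> is
  nonnegative because of the earlier local estimates, so \<open>xtil t\<close> is a convex combination of points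
  of \<open>X\<close>, and \<open>Lf t\<close> is then nonnegative by the smoothness inequality.\<close>

lemma ac_apdhg_in_domain:
  assumes alg: "ac_apdhg X gradf A b \<mu> \<beta> \<eta> \<tau> \<tau>' x xbar xtil y"
    and params: "ac_params \<mu> \<beta>\<^sub>0 \<alpha> LA (loc_Lf f gradf xtil) \<beta> \<eta> \<tau> \<tau>'"
    and "convex X" "smooth_on_with X f gradf L\<^sub>f" "0 < L\<^sub>f"
    and "0 < \<mu>" "\<beta>\<^sub>0 < 1" "0 \<le> \<alpha>" "\<alpha> \<le> 1"
  shows "x t \<in> X" and "xtil t \<in> X" and "1 \<le> t \<Longrightarrow> 0 \<le> loc_Lf f gradf xtil t"
    and "1 \<le> t \<Longrightarrow> 0 \<le> \<tau> t \<and> \<tau>' t = \<tau> t / \<mu>"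
proof -
  have xX: "x t \<in> X" for t
  proof (cases "t = 0")
    case True
    then show ?thesis
      using alg by (simp add: ac_apdhg_def)
  next
    case False
    then show ?thesis
      using ac_apdhg_step(1)[OF alg, of t] by (simp add: is_arg_min_def)
  qed
  have \<tau>': "\<tau>' t = \<tau> t / \<mu>" if t1: "1 \<le> t" for t
  proof -
    consider "t = 1" | "t = 2" | "3 \<le> t"
      using t1 by linarith
    then show ?thesis
    proof cases
      case 3
      then show ?thesis
        using params unfolding ac_params_def by blast
    qed (use ac_params_initial[OF params] \<open>0 < \<mu>\<close> in auto)
  qed
  have Lf: "0 \<le> loc_Lf f gradf xtil s" if "xtil s \<in> X" "xtil (s - 1) \<in> X" for s
    using smooth_bregman_nonneg(2)[OF assms(4,5) that(2,1)]
    by (auto simp: loc_Lf_def bregman_def)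
  have vX: "xtil t \<in> X" for t
  proof (induction t rule: less_induct)
    case (less t)
    show ?case
    proof (cases "t = 0")
      case True
      then show ?thesis
        using alg by (simp add: ac_apdhg_def)
    next
      case False
      define \<rho> where "\<rho> = \<tau>' t"
      have "0 \<le> \<tau> t"
        using False less.IH assms(6-9) by (intro conjunct1[OF conjunct2[OF ac_params_pos[OF params]]] Lf) auto
      then have \<rho>: "0 \<le> \<rho>"
        using \<tau>'[of t] False \<open>0 < \<mu>\<close> by (simp add: \<rho>_def)
      have "xtil t = (1 / (1 + \<rho>)) *\<^sub>R x t + (\<rho> / (1 + \<rho>)) *\<^sub>R xtil (t - 1)"
        using ac_apdhg_step(3)[OF alg, of t] False by (simp add: \<rho>_def scaleR_add_right)
      also have "\<dots> \<in> X"
        using \<open>convex X\<close> xX less.IH[of "t - 1"] False \<rho>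
        by (intro convexD) (auto simp: add_divide_distrib[symmetric])
      finally show ?thesis .
    qed
  qed
  show "x t \<in> X" "xtil t \<in> X"
    using xX vX by auto
  show "0 \<le> loc_Lf f gradf xtil t" "0 \<le> \<tau> t \<and> \<tau>' t = \<tau> t / \<mu>" if "1 \<le> t"
    using Lf[OF vX vX] \<tau>'[OF that] that assms(6-9)
      ac_params_pos[OF params _ _ _ _ Lf[OF vX vX] that] by auto
qed

section \<open>Local smoothness of the penalized function\<close>

lemma loc_LA_mult: "norm (transpose A *v (y t - y (t - 1))) = loc_LA A y t * norm (y t - y (t - 1))"
proof (cases "y t - y (t - 1) = 0")
  case False
  then show ?thesis
    by (simp add: loc_LA_def del: transpose_matrix_vector)
qed (simp only: matrix_vector_mult_0_right norm_zero mult_zero_right)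

text \<open>If the Bregman divergence vanishes, the convention \<open>0/0 = 0\<close> is harmless: the lower smoothness
  inequality forces the gradient difference to vanish as well.\<close>

lemma loc_Lf_mult:
  assumes "smooth_on_with X f gradf L\<^sub>f" "0 < L\<^sub>f" "xtil t \<in> X" "xtil (t - 1) \<in> X" "2 \<le> t"
  shows "(norm (gradf (xtil t) - gradf (xtil (t - 1))))\<^sup>2
    = 2 * loc_Lf f gradf xtil t * bregman f gradf (xtil (t - 1)) (xtil t)"
proof (cases "bregman f gradf (xtil (t - 1)) (xtil t) = 0")
  case True
  have "1 / (2 * L\<^sub>f) * (norm (gradf (xtil t) - gradf (xtil (t - 1))))\<^sup>2 \<le> 0"
    using smooth_bregman_nonneg(1)[OF assms(1,2,4,3)] True by simp
  then show ?thesis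
    using True \<open>0 < L\<^sub>f\<close> by (simp add: divide_le_0_iff)
next
  case False
  then show ?thesis
    using \<open>2 \<le> t\<close> by (simp add: loc_Lf_def bregman_def[symmetric])
qed

text \<open>The local estimate \<open>LA\<close> bounds \<open>A\<^sup>T\<close> on the direction \<open>d = y 1 - y 0\<close>. Since \<open>\<mu> d = A e\<close> with
  \<open>e = xtil 1 - xtil 0\<close>, it also bounds \<open>d\<close> itself, from
  \<open>\<mu> \<parallel>d\<parallel>\<^sup>2 = d \<bullet> A e = A\<^sup>T d \<bullet> e\<close>; using it twice produces \<open>LA\<^sup>2 / \<mu>\<close>.\<close>

lemma local_smoothness_first:
  assumes "0 < \<mu>" and y: "y 1 - y 0 = (1 / \<mu>) *\<^sub>R (A *v (xtil 1 - xtil 0))"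
  shows "norm ((gradf (xtil 1) - gradf (xtil 0)) + transpose A *v (y 1 - y 0))
    \<le> ((loc_LA A y 1)\<^sup>2 / \<mu> + loc_Lf f gradf xtil 1) * norm (xtil 1 - xtil 0)"
proof -
  define d e l where "d = y 1 - y 0" and "e = xtil 1 - xtil 0" and "l = loc_LA A y 1"
  have l: "norm (transpose A *v d) = l * norm d" "0 \<le> l"
    using loc_LA_mult[of A y 1] by (simp_all add: d_def l_def loc_LA_def del: transpose_matrix_vector)
  have "\<mu> * (norm d * norm d) = d \<bullet> (\<mu> *\<^sub>R d)"
    by (simp add: power2_norm_eq_inner[symmetric] power2_eq_square)
  also have "\<mu> *\<^sub>R d = A *v e"
    using y \<open>0 < \<mu>\<close> by (simp add: d_def e_def)
  also have "d \<bullet> (A *v e) \<le> norm (transpose A *v d) * norm e"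
    using norm_cauchy_schwarz[of "transpose A *v d" e] by (simp only: transpose_inner)
  also have "\<dots> = l * norm e * norm d"
    by (simp add: l(1) del: transpose_matrix_vector)
  finally have "(\<mu> * norm d) * norm d \<le> (l * norm e) * norm d"
    by simp
  then have "\<mu> * norm d \<le> l * norm e"
    using l(2) by (cases "norm d = 0") auto
  then have "norm d \<le> l * norm e / \<mu>"
    using \<open>0 < \<mu>\<close> by (simp add: field_simps)
  then have "l * norm d \<le> l * (l * norm e / \<mu>)"
    using l(2) by (rule mult_left_mono)
  then have "norm (transpose A *v d) \<le> l\<^sup>2 / \<mu> * norm e"
    unfolding l(1) by (simp add: power2_eq_square)
  moreover have "norm (gradf (xtil 1) - gradf (xtil 0)) = loc_Lf f gradf xtil 1 * norm e" 
    by (cases "e = 0") (auto simp: loc_Lf_def e_def)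
  ultimately show ?thesis
    using norm_triangle_ineq[of "gradf (xtil 1) - gradf (xtil 0)" "transpose A *v d"]
    unfolding d_def[symmetric] e_def[symmetric] l_def[symmetric] by (simp only: distrib_right)
qed

lemma local_smoothness_later:
  assumes "smooth_on_with X f gradf L\<^sub>f" "0 < L\<^sub>f" "xtil t \<in> X" "xtil (t - 1) \<in> X" "2 \<le> t" "0 < \<mu>"
    and y: "y t - y (t - 1) = (1 / \<mu>) *\<^sub>R (A *v (xtil t - xtil (t - 1)))"
  shows "(norm ((gradf (xtil t) - gradf (xtil (t - 1))) + transpose A *v (y t - y (t - 1))))\<^sup>2
    \<le> 2 * ((loc_LA A y t)\<^sup>2 / \<mu> + loc_Lf f gradf xtil t)
      * (bregman f gradf (xtil (t - 1)) (xtil t) + (norm (A *v (xtil (t - 1) - xtil t)))\<^sup>2 / (2 * \<mu>))"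
proof -
  define d where "d = y t - y (t - 1)"
  have D: "0 \<le> bregman f gradf (xtil (t - 1)) (xtil t)"
    using smooth_bregman_nonneg(2)[OF assms(1,2,4,3)] .
  then have Lf: "0 \<le> loc_Lf f gradf xtil t"
    using \<open>2 \<le> t\<close> by (simp add: loc_Lf_def bregman_def)
  have "A *v (xtil t - xtil (t - 1)) = \<mu> *\<^sub>R d"
    using y \<open>0 < \<mu>\<close> by (simp add: d_def)
  then have "norm (A *v (xtil t - xtil (t - 1))) = \<mu> * norm d"
    using \<open>0 < \<mu>\<close> by simp
  moreover have "norm (A *v (xtil (t - 1) - xtil t)) = norm (A *v (xtil t - xtil (t - 1)))"
    by (simp add: matrix_vector_mult_diff_distrib norm_minus_commute)
  ultimately have E: "(norm (A *v (xtil (t - 1) - xtil t)))\<^sup>2 / (2 * \<mu>) = \<mu> * (norm d)\<^sup>2 / 2"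
    using \<open>0 < \<mu>\<close> by (simp add: power2_eq_square)
  have "(norm ((gradf (xtil t) - gradf (xtil (t - 1))) + transpose A *v d))\<^sup>2
      \<le> (2 * loc_Lf f gradf xtil t + 2 * (loc_LA A y t)\<^sup>2 / \<mu>)
        * (bregman f gradf (xtil (t - 1)) (xtil t) + \<mu> * (norm d)\<^sup>2 / 2)"
  proof (rule norm_add_squared_le)
    show "(norm (transpose A *v d))\<^sup>2 \<le> 2 * (loc_LA A y t)\<^sup>2 / \<mu> * (\<mu> * (norm d)\<^sup>2 / 2)"
      unfolding d_def loc_LA_mult using \<open>0 < \<mu>\<close> by (simp add: power_mult_distrib)
    show "(norm (gradf (xtil t) - gradf (xtil (t - 1))))\<^sup>2
        \<le> 2 * loc_Lf f gradf xtil t * bregman f gradf (xtil (t - 1)) (xtil t)"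
      using loc_Lf_mult[OF assms(1-5)] by simp
  qed (use D Lf \<open>0 < \<mu>\<close> in auto)
  then show ?thesis
    unfolding E d_def[symmetric] by (simp only: distrib_left add.commute times_divide_eq_right)
qed

section \<open>The convergence rate\<close>

lemma sum_lower_bound_quadratic:
  fixes \<eta> :: "nat \<Rightarrow> real"
  assumes "\<And>t. 1 \<le> t \<Longrightarrow> t \<le> k \<Longrightarrow> (3 + \<alpha> * (real (t + 1) - 3)) / (12 * M) \<le> \<eta> (t + 1)"
  shows "(6 * real k + \<alpha> * real k * (real k - 3)) / (24 * M) \<le> (\<Sum>t=1..k. \<eta> (t + 1))"
proof -
  have "(6 * real k + \<alpha> * real k * (real k - 3)) / (24 * M)
      = (\<Sum>t=1..k. (3 + \<alpha> * (real (t + 1) - 3)) / (12 * M))"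
  proof (induction k)
    case (Suc k)
    have "6 * real (Suc k) + \<alpha> * real (Suc k) * (real (Suc k) - 3)
        = (6 * real k + \<alpha> * real k * (real k - 3)) + 2 * (3 + \<alpha> * (real (Suc k + 1) - 3))"
      by (simp add: algebra_simps)
    then show ?case
      using Suc by (simp add: add_divide_distrib)
  qed simp
  also have "\<dots> \<le> (\<Sum>t=1..k. \<eta> (t + 1))"
    using assms by (intro sum_mono) auto
  finally show ?thesis .
qed

text \<open>The larger root of \<open>r\<^sup>2 = 2 \<mu> n r + 2 \<mu> e\<close> is at most \<open>2 \<mu> n + sqrt (2 \<mu> e)\<close>, and
  \<open>sqrt 2 \<le> 2\<close>.\<close>

lemma penalty_residual_bound:
  fixes r n e \<mu> :: real
  assumes "0 \<le> r" "0 \<le> n" "0 < \<mu>" "0 \<le> e" and "r\<^sup>2 / (2 * \<mu>) \<le> e + n * r"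
  shows "r \<le> 2 * \<mu> * n + 2 * sqrt (\<mu> * e)"
proof (rule ccontr)
  define s where "s = sqrt (\<mu> * e)"
  have s: "0 \<le> s" "s\<^sup>2 = \<mu> * e"
    using assms by (auto simp: s_def)
  assume "\<not> ?thesis"
  then have r: "2 * \<mu> * n + 2 * s < r"
    by (simp add: s_def)
  have "0 \<le> 2 * \<mu> * n"
    using assms by simp
  then have r2: "2 * s \<le> r" "0 < r"
    using r s(1) by linarith+
  have "r * r \<le> 2 * s\<^sup>2 + 2 * \<mu> * n * r"
    using assms(3,5) s(2) by (simp add: field_simps power2_eq_square)
  also have "\<dots> \<le> 2 * s * r + 2 * \<mu> * n * r"
    using mult_left_mono[of s r s] r2 s(1) by (simp add: power2_eq_square)
  also have "\<dots> = (2 * \<mu> * n + 2 * s) * r"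
    by (simp add: algebra_simps)
  also have "\<dots> < r * r"
    using r r2(2) by (rule mult_strict_right_mono)
  finally show False
    by simp
qed

theorem proposition4p4:
  fixes X :: "(real^'n) set" and A :: "real^'n^'m" and b :: "real^'m"
    and f :: "real^'n \<Rightarrow> real" and gradf :: "real^'n \<Rightarrow> real^'n" and L\<^sub>f :: real
    and xs :: "real^'n" and ys :: "real^'m"
    and \<mu> \<beta>\<^sub>0 \<alpha> :: real and \<beta> \<eta> \<tau> \<tau>' LA Lf :: "nat \<Rightarrow> real"
    and x xbar xtil :: "nat \<Rightarrow> real^'n" and y :: "nat \<Rightarrow> real^'m" and k :: nat
  assumes "X \<noteq> {}" and "closed X" and "convex X"
    and "convex_on X f" and "L\<^sub>f > 0" and "smooth_on_with X f gradf L\<^sub>f"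
    and "is_arg_min f (\<lambda>u. u \<in> X \<and> A *v u = b) xs"
    and "saddle_point X UNIV (\<lambda>u v. f u + (A *v u - b) \<bullet> v) xs ys"
    and "\<mu> > 0" and "0 < \<beta>\<^sub>0" and "\<beta>\<^sub>0 \<le> 1 - sqrt 6 / 3" and "0 < \<alpha>" and "\<alpha> \<le> 1"
    and "ac_apdhg X gradf A b \<mu> \<beta> \<eta> \<tau> \<tau>' x xbar xtil y"
    and "LA = loc_LA A y" and "Lf = loc_Lf f gradf xtil"
    and "ac_params \<mu> \<beta>\<^sub>0 \<alpha> LA Lf \<beta> \<eta> \<tau> \<tau>'"
    and "init_err \<mu> \<beta>\<^sub>0 LA Lf \<eta> x xs \<ge> 0"
    and "k \<ge> 2"
  shows "f (avg_iterate \<eta> x k) - f xs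
           \<le> 12 * L_hat \<mu> \<beta>\<^sub>0 (\<eta> 1) LA Lf k / (6 * real k + \<alpha> * real k * (real k - 3))
               * init_err \<mu> \<beta>\<^sub>0 LA Lf \<eta> x xs
       \<and> norm (A *v avg_iterate \<eta> x k - b)
           \<le> 2 * \<mu> * norm ys
             + 2 * sqrt (12 * \<mu> * L_hat \<mu> \<beta>\<^sub>0 (\<eta> 1) LA Lf k
                           / (6 * real k + \<alpha> * real k * (real k - 3))
                         * init_err \<mu> \<beta>\<^sub>0 LA Lf \<eta> x xs)"
proof -
  let ?e = "init_err \<mu> \<beta>\<^sub>0 LA Lf \<eta> x xs"
  define F where "F = penalized \<mu> A b f"
  define G where "G = penalized_grad \<mu> A b gradf"
  define T where "T t = \<tau> t / \<mu>" for t
  define L where "L t = (LA t)\<^sup>2 / \<mu> + Lf t" for t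
  define M where "M = L_hat \<mu> \<beta>\<^sub>0 (\<eta> 1) LA Lf k"
  define S where "S = (\<Sum>t=1..k. \<eta> (t + 1))"
  define K where "K = 6 * real k + \<alpha> * real k * (real k - 3)"
  define c where "c = avg_iterate \<eta> x k"
  note \<mu> = \<open>\<mu> > 0\<close>
  note alg = \<open>ac_apdhg X gradf A b \<mu> \<beta> \<eta> \<tau> \<tau>' x xbar xtil y\<close>
  note smooth = \<open>smooth_on_with X f gradf L\<^sub>f\<close>
  note params = \<open>ac_params \<mu> \<beta>\<^sub>0 \<alpha> LA Lf \<beta> \<eta> \<tau> \<tau>'\<close>
  have "2.4 \<le> sqrt 6"
    by (rule real_le_rsqrt) (simp add: power2_eq_square)
  then have \<beta>0: "\<beta>\<^sub>0 \<le> 1 / 5" "\<beta>\<^sub>0 < 1"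
    using \<open>\<beta>\<^sub>0 \<le> 1 - sqrt 6 / 3\<close> by simp_all
  have \<alpha>0: "0 \<le> \<alpha>"
    using \<open>0 < \<alpha>\<close> by simp
  note domain = ac_apdhg_in_domain[OF alg params[unfolded \<open>Lf = loc_Lf f gradf xtil\<close>] \<open>convex X\<close> smooth
      \<open>L\<^sub>f > 0\<close> \<mu> \<beta>0(2) \<alpha>0 \<open>\<alpha> \<le> 1\<close>, folded \<open>Lf = loc_Lf f gradf xtil\<close>]
  have Lf0: "\<forall>s\<ge>1. 0 \<le> Lf s"
    using domain(3) by blast
  note normalized = ac_params_normalized[OF params \<mu> \<beta>0(2) \<alpha>0 \<open>\<alpha> \<le> 1\<close> Lf0,
      folded T_def L_def]
  have pos: "0 < \<eta> t \<and> 0 \<le> \<tau> t \<and> (2 \<le> t \<longrightarrow> 0 < \<tau> t)" if "1 \<le> t" for t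
    using that domain(3) by (intro ac_params_pos[OF params \<mu> \<beta>0(2) \<alpha>0 \<open>\<alpha> \<le> 1\<close>])
  have L0: "0 \<le> L t" if "1 \<le> t" for t
    using domain(3)[OF that] \<mu> by (simp add: L_def)
  have y: "y t = (1 / \<mu>) *\<^sub>R (A *v xtil t - b)" for t
    using ac_apdhg_is_primal[OF alg \<mu> _ order_refl] domain(4) by blast
  have dy: "y s - y t = (1 / \<mu>) *\<^sub>R (A *v (xtil s - xtil t))" for s t
    unfolding y by (simp add: matrix_vector_mult_diff_distrib flip: scaleR_diff_right)
  have G: "G (xtil t) = transpose A *v y t + gradf (xtil t)" for t
    unfolding G_def penalized_grad_def y by (simp add: add.commute)
  have dG: "G (xtil s) - G (xtil t) = (gradf (xtil s) - gradf (xtil t)) + transpose A *v (y s - y t)" for s t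
    unfolding G matrix_vector_mult_diff_distrib by simp
  have bregF: "bregman F G u v = bregman f gradf u v + (norm (A *v (u - v)))\<^sup>2 / (2 * \<mu>)" for u v
    unfolding F_def G_def using \<mu> by (simp add: bregman_penalized)
  have xsX: "xs \<in> X" and Axs: "A *v xs = b"
    using \<open>is_arg_min f (\<lambda>u. u \<in> X \<and> A *v u = b) xs\<close> by (auto simp: is_arg_min_def)
  have init: "xtil 0 = x 0" "xbar 0 = x 0"
    using alg by (auto simp: ac_apdhg_def)
  have xv: "x t = xtil t + T t *\<^sub>R (xtil t - xtil (t - 1))" if "1 \<le> t" for t
  proof -
    have T: "0 \<le> T t" "\<tau>' t = T t"
      using domain(4)[OF that] \<mu> by (auto simp: T_def)
    have "(1 + T t) *\<^sub>R xtil t = x t + T t *\<^sub>R xtil (t - 1)"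
      using ac_apdhg_step(3)[OF alg that] T by simp
    then show ?thesis
      by (simp add: algebra_simps)
  qed
  have T1: "T 1 = 0" and T2: "T 2 = 1"
    using ac_params_initial[OF params] \<mu> by (auto simp: T_def)
  have x1: "xtil 1 = x 1"
    using xv[of 1] T1 by simp
  \<comment> \<open>The dual iterates are eliminated; what is left is the accelerated scheme for \<open>F\<close>.\<close>
  have main: "S * (F c - F xs) \<le> (norm (x 0 - xs))\<^sup>2 / (2 * \<beta>\<^sub>0)
      + (5 / 4 * (\<eta> 2 * L 1) - \<eta> 2 / \<eta> 1 / 4) * (norm (x 1 - x 0))\<^sup>2"
    unfolding S_def c_def avg_iterate_def
  proof (rule accelerated_ergodic_bound[where X = X and G = G and w = xbar and v = xtil and T = T])
    show "0 \<le> bregman F G u v" if "u \<in> X" "v \<in> X" for u v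
      using smooth_bregman_nonneg(2)[OF smooth \<open>L\<^sub>f > 0\<close> that] \<mu> by (simp add: bregF)
    show "0 \<le> (\<eta> t *\<^sub>R G (xtil (t - 1)) + (x t - xbar (t - 1))) \<bullet> (u - x t)" if "1 \<le> t" "u \<in> X" for t u
      unfolding G
      using prox_variational_inequality[OF \<open>closed X\<close> \<open>convex X\<close> ac_apdhg_step(1)[OF alg that(1)] that(2)] .
    show "xbar 1 = x 0"
      using ac_apdhg_step(2)[OF alg, of 1] ac_params_initial(2)[OF params] init by simp
    show "xbar t = (1 - \<beta>\<^sub>0) *\<^sub>R xbar (t - 1) + \<beta>\<^sub>0 *\<^sub>R x t" if "2 \<le> t" for t
    proof -
      have "\<beta> t = \<beta>\<^sub>0"
        using params that unfolding ac_params_def by blast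
      then show ?thesis
        using ac_apdhg_step(2)[OF alg, of t] that by simp
    qed
    show "0 < T t" if "2 \<le> t" for t
      using pos[of t] that \<mu> by (simp add: T_def)
    show "norm (G (xtil 1) - G (xtil 0)) \<le> L 1 * norm (x 1 - x 0)"
      using local_smoothness_first[where gradf = gradf and f = f, OF \<mu> dy[of 1 0]]
      unfolding x1[symmetric] init(1)[symmetric] dG L_def \<open>LA = loc_LA A y\<close> \<open>Lf = loc_Lf f gradf xtil\<close> .
    show "(norm (G (xtil t) - G (xtil (t - 1))))\<^sup>2 \<le> 2 * L t * bregman F G (xtil (t - 1)) (xtil t)"
      if "2 \<le> t" for t
      using local_smoothness_later[OF smooth \<open>L\<^sub>f > 0\<close> domain(2) domain(2) that \<mu> dy[of t "t - 1"]]
      unfolding dG bregF L_def \<open>LA = loc_LA A y\<close> \<open>Lf = loc_Lf f gradf xtil\<close> .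
  qed (use \<open>k \<ge> 2\<close> \<open>convex X\<close> xsX \<open>0 < \<beta>\<^sub>0\<close> \<beta>0 domain(1,2) init xv T1 pos L0 normalized(1,2,4,5,6) in auto)
  also have "\<dots> = ?e / 2"
    using \<mu> by (simp add: init_err_def L_def field_simps)
  finally have main: "S * (F c - F xs) \<le> ?e / 2" .
  have Mge: "1 / (4 * (1 - \<beta>\<^sub>0) * \<eta> 1) \<le> M" "\<And>t. 1 \<le> t \<Longrightarrow> t \<le> k \<Longrightarrow> L t \<le> M"
    unfolding M_def L_hat_def L_def by (rule Max_ge; auto)+
  have d: "0 < 4 * (1 - \<beta>\<^sub>0) * \<eta> 1"
    using \<beta>0 pos[of 1] by simp
  then have M: "0 < M"
    using Mge(1) by (smt (verit) divide_pos_pos)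
  \<comment> \<open>Either entry of the minimum that defines \<open>\<eta> 2\<close> is at least \<open>1 / (4 * M)\<close>: this is why
    \<open>1 / (4 * (1 - \<beta>\<^sub>0) * \<eta> 1)\<close> is one of the entries of \<open>L_hat\<close>.\<close>
  have \<eta>2: "1 / (4 * M) \<le> \<eta> 2"
  proof -
    have "1 \<le> M * (4 * (1 - \<beta>\<^sub>0) * \<eta> 1)"
      using Mge(1) d by (simp add: pos_divide_le_eq)
    then have "1 / (4 * M) \<le> (1 - \<beta>\<^sub>0) * \<eta> 1"
      using M by (simp add: field_simps)
    then show ?thesis
      using normalized(3)[OF Mge(2) M] \<open>k \<ge> 2\<close> by simp
  qed
  have \<eta>_low: "(3 + \<alpha> * (real (t + 1) - 3)) / (12 * M) \<le> \<eta> (t + 1)" if "1 \<le> t" "t \<le> k" for t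
  proof (rule stepsize_lower_bound[where n = "k + 1" and T = T])
    show "min (min (4 / 3 * \<eta> (t - 1)) ((T (t - 2) + 1) / T (t - 1) * \<eta> (t - 1))) (T (t - 1) / (4 * M)) \<le> \<eta> t"
      if "3 \<le> t" "t \<le> k + 1" for t
      using that by (intro normalized(7) Mge(2) M) auto
    show "T (t - 1) + \<alpha> / 2 \<le> T t \<and> T t \<le> T (t - 1) + 1 / 2" if "3 \<le> t" for t
      using that by (rule normalized(8))
  qed (use \<alpha>0 \<open>\<alpha> \<le> 1\<close> M T1 T2 \<eta>2 that in auto)
  have S: "K / (24 * M) \<le> S"
    unfolding K_def S_def using \<eta>_low by (rule sum_lower_bound_quadratic)
  have K: "0 < K"
  proof -
    have "- 1 \<le> \<alpha> * (real k - 3)"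
      using mult_left_mono[of "- 1" "real k - 3" \<alpha>] \<alpha>0 \<open>\<alpha> \<le> 1\<close> \<open>k \<ge> 2\<close> by simp
    then have "0 < real k * (6 + \<alpha> * (real k - 3))"
      using \<open>k \<ge> 2\<close> by (intro mult_pos_pos) auto
    then show ?thesis
      by (simp add: K_def algebra_simps)
  qed
  define \<epsilon> where "\<epsilon> = 12 * M / K * ?e"
  have \<epsilon>0: "0 \<le> \<epsilon>"
    using M K \<open>?e \<ge> 0\<close> by (simp add: \<epsilon>_def)
  have gap: "F c - F xs \<le> \<epsilon>"
  \<comment> \<open>The point \<open>xs\<close> need not minimize \<open>F\<close> on \<open>X\<close>, so the gap may be negative; the lower bound on
    \<open>S\<close> is then of no use, and the claim follows from \<open>0 \<le> \<epsilon>\<close>.\<close>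
  proof (cases "F c - F xs \<le> 0")
    case False
    then have "K / (24 * M) * (F c - F xs) \<le> S * (F c - F xs)"
      using S by (intro mult_right_mono) auto
    also note main
    finally show ?thesis
      using M K by (simp add: \<epsilon>_def field_simps)
  qed (use \<epsilon>0 in linarith)
  define r where "r = norm (A *v c - b)"
  have Fc: "F c = f c + r\<^sup>2 / (2 * \<mu>)" and Fxs: "F xs = f xs"
    by (simp_all add: F_def penalized_def r_def Axs)
  have "0 \<le> r\<^sup>2 / (2 * \<mu>)"
    using \<mu> by simp
  then have first: "f c - f xs \<le> \<epsilon>"
    using gap Fc Fxs by linarith
  have cX: "c \<in> X"
  proof -
    have S0: "0 < S"
      unfolding S_def using pos \<open>k \<ge> 2\<close> by (intro sum_pos) auto
    have "c = (\<Sum>t=1..k. (\<eta> (t + 1) / S) *\<^sub>R x t)"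
      by (simp add: c_def avg_iterate_def S_def scaleR_sum_right)
    also have "\<dots> \<in> X"
      using S0 pos domain(1) \<open>convex X\<close>
      by (intro convex_sum) (auto simp: S_def sum_divide_distrib[symmetric] less_imp_le)
    finally show ?thesis .
  qed
  have "f xs + (A *v xs - b) \<bullet> ys \<le> f c + (A *v c - b) \<bullet> ys"
    using \<open>saddle_point X UNIV (\<lambda>u v. f u + (A *v u - b) \<bullet> v) xs ys\<close> cX
    unfolding saddle_point_def by blast
  moreover have "(A *v c - b) \<bullet> ys \<le> norm ys * r"
    using norm_cauchy_schwarz[of "A *v c - b" ys] by (simp add: r_def mult.commute)
  ultimately have "r\<^sup>2 / (2 * \<mu>) \<le> \<epsilon> + norm ys * r"
    using gap Fc Fxs Axs by simp
  then have second: "r \<le> 2 * \<mu> * norm ys + 2 * sqrt (\<mu> * \<epsilon>)"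
    using \<mu> \<epsilon>0 by (intro penalty_residual_bound) (auto simp: r_def)
  have "12 * \<mu> * M / K * ?e = \<mu> * \<epsilon>"
    by (simp add: \<epsilon>_def)
  with first second show ?thesis
    unfolding c_def[symmetric] r_def[symmetric] M_def[symmetric] K_def[symmetric]
    by (simp only: \<epsilon>_def[symmetric])
qed

end
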